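(* Let $\Gamma$ be a finitely presented group and let $(\Gamma_n)$ be an arbitrary chain in $\Gamma$. Then at least one of the following holds: (1) the boundary action of $\Gamma$ with respect to $(\Gamma_n)$ is strongly ergodic; (2) $\mathrm{RG}(\Gamma,(\Gamma_n))=0$; (3) there exists $n$ such that $\Gamma_n$ is a non-trivial amalgamated product.
   Context: A chain in $\Gamma$ is a decreasing infinite sequence $\Gamma=\Gamma_0>\Gamma_1>\cdots$ of finite index subgroups. With $d(H)$ the minimal number of generators of $H$, $r(\Gamma,H)=(d(H)-1)/|\Gamma:H|$ and $\mathrm{RG}(\Gamma,(\Gamma_n))=\lim_n r(\Gamma,\Gamma_n)$. Coset tree and boundary action: the coset tree $T$ has vertex set $\{g\Gamma_n : n\ge 0, g\in\Gamma\}$, with an edge between $g\Gamma_n$ and $h\Gamma_{n+1}$ whenever $g\Gamma_n\supseteq h\Gamma_{n+1}$; it is rooted at $\Gamma$, and $\Gamma$ acts on it by left multiplication. The boundary $\partial T$ is the set of infinite rays from the root, with the topology whose basis consists of the shadows $\mathrm{Sh}(g\Gamma_n)=\{$rays passing through $g\Gamma_n\}$, and with the Borel probability measure $\mu$ determined by $\mu(\mathrm{Sh}(g\Gamma_n))=1/|\Gamma:\Gamma_n|$. The measure-preserving action of $\Gamma$ on $(\partial T,\mu)$ is the boundary action with respect to $(\Gamma_n)$. Strong ergodicity: for a measure-preserving action of $\Gamma$ on a probability space $(X,\mu)$, a sequence of measurable sets $A_n\subseteq X$ is almost invariant if $\mu(A_n\setminus A_n\gamma)\to0$ for every $\gamma\in\Gamma$,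 and trivial if $\mu(A_n)(1-\mu(A_n))\to 0$; the action is strongly ergodic if every almost invariant sequence is trivial. A group $G$ is a non-trivial amalgamated product $A_1*_{A_3}A_2$ if $G\cong A_1*_{A_3}A_2$ where the subgroup $A_3=A_1\cap A_2$ is equal to neither $A_1$ nor $A_2$ and has index at least $3$ in one of them. *)

theory Defs
  imports "HOL-Algebra.Left_Coset" "HOL-Algebra.Generated_Groups" "HOL-Probability.Probability"
begin

fun word_eval :: "('a, 'b) monoid_scheme \<Rightarrow> ('a \<times> bool) list \<Rightarrow> 'a" where
  "word_eval G [] = \<one>\<^bsub>G\<^esub>"
| "word_eval G ((s, b) # w) =
     (if b then inv\<^bsub>G\<^esub> s else s) \<otimes>\<^bsub>G\<^esub> word_eval G w"

definition words_over :: "'a set \<Rightarrow> ('a \<times> bool) list set" where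
  "words_over S = {w. \<forall>l \<in> set w. fst l \<in> S}"

definition inv_letter :: "'a \<times> bool \<Rightarrow> 'a \<times> bool" where
  "inv_letter l = (fst l, \<not> snd l)"

definition inv_word :: "('a \<times> bool) list \<Rightarrow> ('a \<times> bool) list" where
  "inv_word w = rev (map inv_letter w)"

text \<open>Words lying in the normal closure of the relators R in the free group on the
  generators: the closure of the empty word under insertion/deletion of cancelling pairs
  and insertion of relators and their inverses.\<close>

inductive consequence :: "('a \<times> bool) list set \<Rightarrow> ('a \<times> bool) list \<Rightarrow> bool"
  for R where
  empty: "consequence R []"
| ins_pair: "consequence R (u @ v) \<Longrightarrow> consequence R (u @ [l, inv_letter l] @ v)"
| del_pair: "consequence R (u @ [l, inv_letter l] @ v) \<Longrightarrow> consequence R (u @ v)"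
| ins_rel: "r \<in> R \<Longrightarrow> consequence R (u @ v) \<Longrightarrow> consequence R (u @ r @ v)"
| ins_rel_inv: "r \<in> R \<Longrightarrow> consequence R (u @ v) \<Longrightarrow> consequence R (u @ inv_word r @ v)"

definition finitely_presented :: "('a, 'b) monoid_scheme \<Rightarrow> bool" where
  "finitely_presented G \<longleftrightarrow> group G \<and>
     (\<exists>S R. finite S \<and> S \<subseteq> carrier G \<and> generate G S = carrier G \<and>
        finite R \<and> R \<subseteq> words_over S \<and>
        (\<forall>r \<in> R. word_eval G r = \<one>\<^bsub>G\<^esub>) \<and>
        (\<forall>w \<in> words_over S. word_eval G w = \<one>\<^bsub>G\<^esub> \<longrightarrow> consequence R w))"

text \<open>Index |G : H|, as a natural number (meaningful for finite index subgroups).\<close>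

definition group_index :: "('a, 'b) monoid_scheme \<Rightarrow> 'a set \<Rightarrow> nat" where
  "group_index G H = card (lcosets\<^bsub>G\<^esub> H)"

definition finite_index :: "('a, 'b) monoid_scheme \<Rightarrow> 'a set \<Rightarrow> bool" where
  "finite_index G H \<longleftrightarrow> subgroup H G \<and> finite (lcosets\<^bsub>G\<^esub> H)"

definition is_chain :: "('a, 'b) monoid_scheme \<Rightarrow> (nat \<Rightarrow> 'a set) \<Rightarrow> bool" where
  "is_chain G \<Gamma> \<longleftrightarrow> \<Gamma> 0 = carrier G \<and> (\<forall>n. finite_index G (\<Gamma> n)) \<and>
     (\<forall>n. \<Gamma> (Suc n) \<subset> \<Gamma> n)"

definition min_gens :: "('a, 'b) monoid_scheme \<Rightarrow> 'a set \<Rightarrow> nat" where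
  "min_gens G H = (LEAST n. \<exists>A. A \<subseteq> H \<and> finite A \<and> card A = n \<and> generate G A = H)"

definition rg_term :: "('a, 'b) monoid_scheme \<Rightarrow> 'a set \<Rightarrow> real" where
  "rg_term G H = (real (min_gens G H) - 1) / real (group_index G H)"

definition rank_gradient_zero :: "('a, 'b) monoid_scheme \<Rightarrow> (nat \<Rightarrow> 'a set) \<Rightarrow> bool" where
  "rank_gradient_zero G \<Gamma> \<longleftrightarrow> (\<lambda>n. rg_term G (\<Gamma> n)) \<longlonglongrightarrow> 0"

text \<open>A ray from the root: a sequence of vertices c n = g Gamma_n with c (n+1) a subset of c n.\<close>

definition tree_boundary :: "('a, 'b) monoid_scheme \<Rightarrow> (nat \<Rightarrow> 'a set) \<Rightarrow> (nat \<Rightarrow> 'a set) set" where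
  "tree_boundary G \<Gamma> = {c. (\<forall>n. c n \<in> lcosets\<^bsub>G\<^esub> (\<Gamma> n)) \<and> (\<forall>n. c (Suc n) \<subseteq> c n)}"

definition shadow :: "('a, 'b) monoid_scheme \<Rightarrow> (nat \<Rightarrow> 'a set) \<Rightarrow> nat \<Rightarrow> 'a set \<Rightarrow> (nat \<Rightarrow> 'a set) set" where
  "shadow G \<Gamma> n C = {c \<in> tree_boundary G \<Gamma>. c n = C}"

definition shadows :: "('a, 'b) monoid_scheme \<Rightarrow> (nat \<Rightarrow> 'a set) \<Rightarrow> (nat \<Rightarrow> 'a set) set set" where
  "shadows G \<Gamma> = {shadow G \<Gamma> n C | n C. C \<in> lcosets\<^bsub>G\<^esub> (\<Gamma> n)}"

text \<open>M is the boundary measure: the Borel probability measure on the boundary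
  (sigma algebra generated by the shadows, which form a basis of the topology)
  with mu(Sh(g Gamma_n)) = 1 / |Gamma : Gamma_n|.\<close>

definition boundary_measure ::
  "('a, 'b) monoid_scheme \<Rightarrow> (nat \<Rightarrow> 'a set) \<Rightarrow> (nat \<Rightarrow> 'a set) measure \<Rightarrow> bool" where
  "boundary_measure G \<Gamma> M \<longleftrightarrow> prob_space M \<and>
     space M = tree_boundary G \<Gamma> \<and>
     sets M = sigma_sets (tree_boundary G \<Gamma>) (shadows G \<Gamma>) \<and>
     (\<forall>n C. C \<in> lcosets\<^bsub>G\<^esub> (\<Gamma> n) \<longrightarrow>
        measure M (shadow G \<Gamma> n C) = 1 / real (group_index G (\<Gamma> n)))"

definition boundary_act :: "('a, 'b) monoid_scheme \<Rightarrow> 'a \<Rightarrow> (nat \<Rightarrow> 'a set) \<Rightarrow> (nat \<Rightarrow> 'a set)" where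
  "boundary_act G g c = (\<lambda>n. g <#\<^bsub>G\<^esub> c n)"

definition strongly_ergodic_action ::
  "('a, 'b) monoid_scheme \<Rightarrow> ('a \<Rightarrow> 'x \<Rightarrow> 'x) \<Rightarrow> 'x measure \<Rightarrow> bool" where
  "strongly_ergodic_action G act M \<longleftrightarrow>
     (\<forall>A :: nat \<Rightarrow> 'x set. (\<forall>n. A n \<in> sets M) \<longrightarrow>
        (\<forall>g \<in> carrier G. (\<lambda>n. measure M (A n - act g ` A n)) \<longlonglongrightarrow> 0) \<longrightarrow>
        (\<lambda>n. measure M (A n) * (1 - measure M (A n))) \<longlonglongrightarrow> 0)"

definition boundary_action_strongly_ergodic :: "('a, 'b) monoid_scheme \<Rightarrow> (nat \<Rightarrow> 'a set) \<Rightarrow> bool" where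
  "boundary_action_strongly_ergodic G \<Gamma> \<longleftrightarrow>
     (\<exists>M. boundary_measure G \<Gamma> M \<and> strongly_ergodic_action G (boundary_act G) M)"

text \<open>H (a subgroup of G) is the internal amalgamated free product of its subgroups A1, A2
  over A1 \<inter> A2: A1 \<union> A2 generates H, and no reduced alternating product
  g_1 ... g_k (k \<ge> 1, g_i in (A1 \<union> A2) - (A1 \<inter> A2), consecutive factors from different A_j)
  equals 1; i.e. the canonical map A1 *_{A1\<inter>A2} A2 \<rightarrow> H is an isomorphism.\<close>

definition reduced_alternating :: "'a set \<Rightarrow> 'a set \<Rightarrow> 'a list \<Rightarrow> bool" where
  "reduced_alternating A1 A2 gs \<longleftrightarrow> gs \<noteq> [] \<and>
     (\<forall>g \<in> set gs. g \<in> (A1 \<union> A2) - (A1 \<inter> A2)) \<and>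
     (\<forall>i. Suc i < length gs \<longrightarrow> ((gs ! i \<in> A1) \<longleftrightarrow> (gs ! Suc i \<notin> A1)))"

definition is_amalgamated_product ::
  "('a, 'b) monoid_scheme \<Rightarrow> 'a set \<Rightarrow> 'a set \<Rightarrow> 'a set \<Rightarrow> bool" where
  "is_amalgamated_product G H A1 A2 \<longleftrightarrow>
     subgroup A1 G \<and> subgroup A2 G \<and> A1 \<subseteq> H \<and> A2 \<subseteq> H \<and>
     generate G (A1 \<union> A2) = H \<and>
     (\<forall>gs. reduced_alternating A1 A2 gs \<longrightarrow> foldr (\<otimes>\<^bsub>G\<^esub>) gs \<one>\<^bsub>G\<^esub> \<noteq> \<one>\<^bsub>G\<^esub>)"

definition rel_index_ge3 :: "('a, 'b) monoid_scheme \<Rightarrow> 'a set \<Rightarrow> 'a set \<Rightarrow> bool" where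
  "rel_index_ge3 G A B \<longleftrightarrow>
     (let C = (\<lambda>a. a <#\<^bsub>G\<^esub> B) ` A in infinite C \<or> card C \<ge> 3)"

definition nontrivial_amalgam :: "('a, 'b) monoid_scheme \<Rightarrow> 'a set \<Rightarrow> bool" where
  "nontrivial_amalgam G H \<longleftrightarrow>
     (\<exists>A1 A2. is_amalgamated_product G H A1 A2 \<and>
        A1 \<inter> A2 \<noteq> A1 \<and> A1 \<inter> A2 \<noteq> A2 \<and>
        (rel_index_ge3 G A1 (A1 \<inter> A2) \<or> rel_index_ge3 G A2 (A1 \<inter> A2)))"

end

theory Submission
  imports Defs
begin

text \<open>Let \<open>V = \<Gamma>/\<Gamma>\<^sub>n\<close> be the vertex set of the Schreier graph of \<open>\<Gamma>\<^sub>n\<close>. A spanning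
  tree yields one Schreier generator of \<open>\<Gamma>\<^sub>n\<close> per edge, and the relator loops present
  \<open>\<Gamma>\<^sub>n\<close> on these generators. If the edges are covered by two sets such that every relator loop
  lies in one of them, then \<open>\<Gamma>\<^sub>n\<close> is the amalgam of the two subgroups that they generate, over
  the subgroup generated by the common edges. This is seen by letting \<open>\<Gamma>\<close> act on the product of \<open>V\<close>
  with van der Waerden's normal forms.

  If the boundary action is not strongly ergodic, then almost invariant sets, approximated by
  clopen sets and intersected repeatedly, give colourings of \<open>V\<close> with arbitrarily small colour
  classes and arbitrarily few edges between different colours. Splitting \<open>\<Gamma>\<^sub>n\<close> along one
  colour at a time, the triviality of all these amalgams bounds \<open>d(\<Gamma>\<^sub>n)\<close> by a small multiple of
  the index. By Schreier's bound the rank gradient then vanishes.\<close>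

text \<open>A presentation of \<open>\<Gamma> n\<close> is never written down; that of the whole
  group is used directly. The group should act by g (v, \<omega>) = (g v, c(g, v) \<omega>), where c
  is the Schreier cocycle with values in \<open>\<Gamma> n\<close>. For general g, however, c(g, v)
  lies in neither side and has no evident action on normal forms; only single letters do. Hence
  words act letter by letter, and relators must be shown to act trivially. A loop inside one side
  does so because that side acts as a group. This is why loops that change colour are put into both
  sets, and finitely many relators keep this overlap proportional to the number of colour-changing
  edges. The rank estimate is a constant times that number, plus the largest colour class times the
  number of generators, plus 2; the 2 pays for amalgams in which both indices are 2. The colour
  classes shrink by a factor that does not depend on the precision required of the edges, so both
  terms can be made small at one level.\<close>

no_notation (ASCII) subset_mset (infix "<#" 50)

section \<open>Normal forms in an amalgamated product\<close>

text \<open>Indexing the factors by \<open>bool\<close> lets each argument be made once for both.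
  \<open>C\<close> is just some common subgroup here; that it is the whole intersection only follows
  later, from the absence of trivial alternating products.\<close>

locale amalgam_pair = group G for G (structure) +
  fixes A :: "bool \<Rightarrow> 'a set" and C :: "'a set"
  assumes subgroup_A: "subgroup (A i) G" and subgroup_C: "subgroup C G" and C_le: "C \<subseteq> A i"
begin

lemma A_carrier: "a \<in> A i \<Longrightarrow> a \<in> carrier G"
  using subgroup.subset[OF subgroup_A] by blast

lemma C_carrier: "a \<in> C \<Longrightarrow> a \<in> carrier G"
  using C_le A_carrier by blast

lemma C_A: "c \<in> C \<Longrightarrow> c \<in> A i"
  using C_le by blast

lemmas A_m = subgroup.m_closed[OF subgroup_A]
lemmas A_inv = subgroup.m_inv_closed[OF subgroup_A]
lemmas C_m = subgroup.m_closed[OF subgroup_C]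
lemmas C_inv = subgroup.m_inv_closed[OF subgroup_C]
lemmas C_one = subgroup.one_closed[OF subgroup_C]

text \<open>The choice is applied to the coset as a set, so it is constant on right cosets of
  \<open>C\<close> by construction. The representative of \<open>C\<close> itself need not be
  \<one>; it never enters a normal form, since \<open>join\<close> treats elements of
  \<open>C\<close> separately.\<close>

definition coset_rep :: "'a \<Rightarrow> 'a" where
  "coset_rep m = (SOME y. y \<in> C #> m)"

lemma coset_rep_ex:
  assumes "m \<in> carrier G"
  obtains c where "c \<in> C" "coset_rep m = c \<otimes> m"
proof -
  have "m \<in> C #> m"
    using assms rcos_self subgroup_C by blast
  then have "coset_rep m \<in> C #> m"
    unfolding coset_rep_def by (rule someI)
  then show ?thesis
    using that by (auto simp: r_coset_def)
qed

lemma coset_rep_mult: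
  assumes "c \<in> C" "m \<in> carrier G"
  shows "coset_rep (c \<otimes> m) = coset_rep m"
proof -
  have "C #> (c \<otimes> m) = (C #> c) #> m"
    using assms C_carrier coset_mult_assoc[of C c m] subgroup.subset[OF subgroup_C] by simp
  also have "C #> c = C"
    using assms(1) coset_join2 subgroup_C C_carrier by blast
  finally show ?thesis
    by (simp add: coset_rep_def)
qed

lemma coset_rep_idem: "m \<in> carrier G \<Longrightarrow> coset_rep (coset_rep m) = coset_rep m"
  by (metis coset_rep_ex coset_rep_mult)

lemma coset_rep_A:
  assumes "m \<in> A i"
  shows "coset_rep m \<in> A i"
  using assms by (metis A_carrier A_m C_A coset_rep_ex)

lemma coset_rep_notin_C:
  assumes "m \<in> carrier G" "m \<notin> C"
  shows "coset_rep m \<notin> C"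
proof
  assume *: "coset_rep m \<in> C"
  obtain c where c: "c \<in> C" "coset_rep m = c \<otimes> m"
    using coset_rep_ex[OF assms(1)] .
  then have "m = inv c \<otimes> coset_rep m"
    using assms C_carrier by (simp add: m_assoc[symmetric])
  then show False
    using * c C_m C_inv assms(2) by metis
qed

lemma coset_rep_quot:
  assumes "m \<in> carrier G"
  shows "m \<otimes> inv (coset_rep m) \<in> C"
proof -
  obtain c where c: "c \<in> C" "coset_rep m = c \<otimes> m"
    using coset_rep_ex[OF assms] .
  then have "m \<otimes> inv (coset_rep m) = inv c"
    using assms C_carrier by (simp add: inv_mult_group m_assoc[symmetric])
  then show ?thesis
    using c C_inv by simp
qed

definition starts :: "bool \<Rightarrow> (bool \<times> 'a) list \<Rightarrow> bool" where
  "starts i ts \<longleftrightarrow> ts \<noteq> [] \<and> fst (hd ts) = i"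

lemma starts_simps [simp]: "\<not> starts i []" "starts i (p # ts) \<longleftrightarrow> fst p = i"
  by (auto simp: starts_def)

primrec normal_tail :: "(bool \<times> 'a) list \<Rightarrow> bool" where
  "normal_tail [] \<longleftrightarrow> True"
| "normal_tail (p # ts) \<longleftrightarrow> snd p \<in> A (fst p) \<and> snd p \<notin> C \<and> coset_rep (snd p) = snd p \<and>
     \<not> starts (fst p) ts \<and> normal_tail ts"

text \<open>The pair \<open>(c, [(i\<^sub>1, t\<^sub>1), \<dots>, (i\<^sub>k, t\<^sub>k)])\<close> stands for the element
  \<open>c t\<^sub>1 \<dots> t\<^sub>k\<close> of the amalgam, where \<open>t\<^sub>j\<close> represents a right coset of \<open>C\<close> in \<open>A i\<^sub>j\<close>.\<close>

definition normal_forms :: "('a \<times> (bool \<times> 'a) list) set" where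
  "normal_forms = {(c, ts). c \<in> C \<and> normal_tail ts}"

text \<open>\<open>front i\<close> and \<open>rest i\<close> identify the normal forms with pairs of
  an element of \<open>A i\<close> and a tail that does not start in factor i; \<open>join i\<close>
  is the inverse. In these coordinates \<open>nf_act i\<close> is left multiplication on the first
  component, so the laws of an action follow at once.\<close>

definition front :: "bool \<Rightarrow> 'a \<times> (bool \<times> 'a) list \<Rightarrow> 'a" where
  "front i p = (if starts i (snd p) then fst p \<otimes> snd (hd (snd p)) else fst p)"

definition rest :: "bool \<Rightarrow> 'a \<times> (bool \<times> 'a) list \<Rightarrow> (bool \<times> 'a) list" where
  "rest i p = (if starts i (snd p) then tl (snd p) else snd p)"

definition join :: "bool \<Rightarrow> 'a \<Rightarrow> (bool \<times> 'a) list \<Rightarrow> 'a \<times> (bool \<times> 'a) list" where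
  "join i m ts = (if m \<in> C then (m, ts) else (m \<otimes> inv (coset_rep m), (i, coset_rep m) # ts))"

definition nf_act :: "bool \<Rightarrow> 'a \<Rightarrow> 'a \<times> (bool \<times> 'a) list \<Rightarrow> 'a \<times> (bool \<times> 'a) list" where
  "nf_act i a p = join i (a \<otimes> front i p) (rest i p)"

lemma front_rest:
  assumes "p \<in> normal_forms"
  shows "front i p \<in> A i" "normal_tail (rest i p)" "\<not> starts i (rest i p)"
    "join i (front i p) (rest i p) = p"
proof -
  obtain c ts where p: "p = (c, ts)" "c \<in> C" "normal_tail ts"
    using assms by (auto simp: normal_forms_def)
  have "front i p \<in> A i \<and> normal_tail (rest i p) \<and> \<not> starts i (rest i p)
        \<and> join i (front i p) (rest i p) = p"
  proof (cases "starts i ts")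
    case False
    then show ?thesis
      using p C_A by (auto simp: front_def rest_def join_def)
  next
    case True
    then obtain t us where ts: "ts = (i, t) # us"
      by (cases ts) auto
    have t: "t \<in> A i" "t \<notin> C" "coset_rep t = t" "t \<in> carrier G" "c \<in> carrier G"
      using p(2,3) A_carrier C_carrier by (auto simp: ts)
    have "c \<otimes> t \<notin> C"
    proof
      assume "c \<otimes> t \<in> C"
      then have "inv c \<otimes> (c \<otimes> t) \<in> C"
        using p(2) C_m C_inv by blast
      then show False
        using t by (simp add: m_assoc[symmetric])
    qed
    then show ?thesis
      using p t C_A A_m
      by (auto simp: front_def rest_def join_def ts coset_rep_mult m_assoc)
  qed
  then show "front i p \<in> A i" "normal_tail (rest i p)" "\<not> starts i (rest i p)"
    "join i (front i p) (rest i p) = p" by auto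
qed

lemma join_props:
  assumes "m \<in> A i" "normal_tail ts" "\<not> starts i ts"
  shows "join i m ts \<in> normal_forms" "front i (join i m ts) = m" "rest i (join i m ts) = ts"
  using assms A_carrier[OF assms(1)] coset_rep_quot coset_rep_notin_C coset_rep_idem
    coset_rep_A[OF assms(1)] A_carrier[OF coset_rep_A[OF assms(1)]]
  by (auto simp: join_def normal_forms_def front_def rest_def m_assoc)

lemma nf_act_closed:
  "a \<in> A i \<Longrightarrow> p \<in> normal_forms \<Longrightarrow> nf_act i a p \<in> normal_forms"
  unfolding nf_act_def by (intro join_props A_m front_rest)

lemma nf_act_mult:
  assumes "a \<in> A i" "b \<in> A i" "p \<in> normal_forms"
  shows "nf_act i (a \<otimes> b) p = nf_act i a (nf_act i b p)"
  using assms front_rest[OF assms(3), of i] A_carrier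
  by (simp add: nf_act_def join_props A_m m_assoc)

lemma nf_act_one:
  assumes "p \<in> normal_forms"
  shows "nf_act i \<one> p = p"
  using front_rest[OF assms, of i] A_carrier by (simp add: nf_act_def)

text \<open>The result does not depend on i: on \<open>C\<close> the two actions agree. This
  compatibility allows both to be used on the same set of normal forms.\<close>

lemma nf_act_C:
  assumes "c \<in> C" "p \<in> normal_forms"
  shows "nf_act i c p = (c \<otimes> fst p, snd p)"
proof -
  have p: "fst p \<in> C" "normal_tail (snd p)"
    using assms by (auto simp: normal_forms_def)
  have "(c \<otimes> fst p, snd p) \<in> normal_forms"
    using assms p C_m by (auto simp: normal_forms_def)
  moreover have "c \<otimes> front i p = front i (c \<otimes> fst p, snd p)"
  proof (cases "starts i (snd p)")
    case True
    then have "snd (hd (snd p)) \<in> carrier G"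
      using p(2) A_carrier by (cases "snd p") auto
    then show ?thesis
      using True p assms C_carrier by (simp add: front_def m_assoc)
  qed (simp add: front_def)
  moreover have "rest i p = rest i (c \<otimes> fst p, snd p)"
    by (simp add: rest_def)
  ultimately show ?thesis
    unfolding nf_act_def using front_rest(4) by metis
qed

lemma nf_act_longer:
  assumes "a \<in> A i" "a \<notin> C" "p \<in> normal_forms" "\<not> starts i (snd p)"
  shows "length (snd (nf_act i a p)) = Suc (length (snd p))" "starts i (snd (nf_act i a p))"
proof -
  have c: "fst p \<in> C" using assms by (auto simp: normal_forms_def)
  have "a \<otimes> fst p \<notin> C"
  proof
    assume "a \<otimes> fst p \<in> C"
    then have "a \<otimes> fst p \<otimes> inv (fst p) \<in> C"
      using c C_m C_inv by blast
    then show False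
      using assms c A_carrier[OF assms(1)] C_carrier by (simp add: m_assoc)
  qed
  then show "length (snd (nf_act i a p)) = Suc (length (snd p))" "starts i (snd (nf_act i a p))"
    using assms by (auto simp: nf_act_def front_def rest_def join_def)
qed

primrec alternating :: "(bool \<times> 'a) list \<Rightarrow> bool" where
  "alternating [] \<longleftrightarrow> True"
| "alternating (p # ps) \<longleftrightarrow> snd p \<in> A (fst p) \<and> snd p \<notin> C \<and> \<not> starts (fst p) ps \<and> alternating ps"

definition base_form :: "'a \<times> (bool \<times> 'a) list" where
  "base_form = (\<one>, [])"

lemma base_form [simp]: "base_form \<in> normal_forms"
  by (simp add: base_form_def normal_forms_def C_one)

text \<open>Each factor meets a tail that does not start in its own side, so nothing cancels and the
  tail grows by one. The side in which the tail starts is part of the claim because the next step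
  depends on it.\<close>

lemma alternating_act:
  assumes "alternating ps"
  shows "foldr (\<lambda>(i, a). nf_act i a) ps base_form \<in> normal_forms \<and>
    length (snd (foldr (\<lambda>(i, a). nf_act i a) ps base_form)) = length ps \<and>
    (\<forall>i. starts i (snd (foldr (\<lambda>(i, a). nf_act i a) ps base_form)) \<longleftrightarrow> starts i ps)"
  using assms
proof (induction ps)
  case Nil
  then show ?case by (simp add: base_form_def[symmetric]) (simp add: base_form_def)
next
  case (Cons p ps)
  obtain i a where p: "p = (i, a)" by force
  let ?q = "foldr (\<lambda>(i, a). nf_act i a) ps base_form"
  have IH: "?q \<in> normal_forms" "length (snd ?q) = length ps" "\<not> starts i (snd ?q)"
    and a: "a \<in> A i" "a \<notin> C"
    using Cons by (auto simp: p)
  show ?case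
    using nf_act_closed[OF a(1) IH(1)] nf_act_longer[OF a IH(1,3)] IH(2)
    by (auto simp: p starts_def)
qed

end

section \<open>Schreier graphs\<close>

definition letter_value :: "('a, 'b) monoid_scheme \<Rightarrow> 'a \<times> bool \<Rightarrow> 'a" where
  "letter_value G l = (if snd l then inv\<^bsub>G\<^esub> (fst l) else fst l)"

lemma word_eval_Cons: "word_eval G (l # w) = letter_value G l \<otimes>\<^bsub>G\<^esub> word_eval G w"
  by (cases l) (simp add: letter_value_def)

lemma words_over_simps [simp]:
  "[] \<in> words_over S"
  "l # w \<in> words_over S \<longleftrightarrow> fst l \<in> S \<and> w \<in> words_over S"
  "u @ w \<in> words_over S \<longleftrightarrow> u \<in> words_over S \<and> w \<in> words_over S"
  by (auto simp: words_over_def)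

lemma fst_inv_letter [simp]: "fst (inv_letter l) = fst l"
  by (simp add: inv_letter_def)

lemma inv_letter_inv_letter [simp]: "inv_letter (inv_letter l) = l"
  by (simp add: inv_letter_def)

lemma inv_word_simps [simp]:
  "inv_word [] = []" "inv_word (l # w) = inv_word w @ [inv_letter l]"
  by (simp_all add: inv_word_def)

lemma inv_word_words_over [simp]: "inv_word w \<in> words_over S \<longleftrightarrow> w \<in> words_over S"
  by (auto simp: words_over_def inv_word_def)

context group
begin

lemma letter_value_closed: "fst l \<in> carrier G \<Longrightarrow> letter_value G l \<in> carrier G"
  by (simp add: letter_value_def)

lemma letter_value_inv_letter:
  "fst l \<in> carrier G \<Longrightarrow> letter_value G (inv_letter l) = inv (letter_value G l)"
  by (simp add: letter_value_def inv_letter_def)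

lemma word_eval_closed:
  "S \<subseteq> carrier G \<Longrightarrow> w \<in> words_over S \<Longrightarrow> word_eval G w \<in> carrier G"
  by (induction w) (auto simp: word_eval_Cons letter_value_closed subset_iff simp del: word_eval.simps(2))

lemma word_eval_append:
  assumes "S \<subseteq> carrier G" "u \<in> words_over S" "w \<in> words_over S"
  shows "word_eval G (u @ w) = word_eval G u \<otimes> word_eval G w"
  using assms(2)
proof (induction u)
  case Nil
  then show ?case using word_eval_closed assms by simp
next
  case (Cons l u)
  then show ?case
    using assms word_eval_closed[OF assms(1)]
    by (auto simp: word_eval_Cons m_assoc letter_value_closed subset_iff simp del: word_eval.simps(2))
qed

lemma word_eval_inv_word:
  assumes "S \<subseteq> carrier G" "w \<in> words_over S"
  shows "word_eval G (inv_word w) = inv (word_eval G w)"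
  using assms(2)
proof (induction w)
  case (Cons l w)
  have l: "fst l \<in> carrier G" and w: "w \<in> words_over S" using Cons assms by auto
  have "word_eval G (inv_word (l # w)) = inv (word_eval G w) \<otimes> letter_value G (inv_letter l)"
    using Cons assms l by (simp add: word_eval_append[OF assms(1)] word_eval_Cons letter_value_closed
        del: word_eval.simps(2))
  then show ?case
    using l w word_eval_closed[OF assms(1)]
    by (simp add: letter_value_inv_letter word_eval_Cons inv_mult_group letter_value_closed
        del: word_eval.simps(2))
qed simp

lemma generate_word:
  assumes "S \<subseteq> carrier G" "g \<in> generate G S"
  obtains w where "w \<in> words_over S" "word_eval G w = g"
proof -
  have "\<exists>w. w \<in> words_over S \<and> word_eval G w = g"
    using assms(2)
  proof induction
    case one
    then show ?case by (intro exI[of _ "[]"]) simp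
  next
    case (incl h)
    then show ?case using assms by (intro exI[of _ "[(h, False)]"]) auto
  next
    case (inv h)
    then show ?case using assms by (intro exI[of _ "[(h, True)]"]) auto
  next
    case (eng g h)
    then show ?case by (metis words_over_simps(3) word_eval_append[OF assms(1)])
  qed
  then show ?thesis using that by blast
qed

lemma lcosets_act:
  assumes "subgroup H G" "v \<in> lcosets H" "g \<in> carrier G"
  shows "g <# v \<in> lcosets H"
  using assms lcos_m_assoc[OF subgroup.subset[OF assms(1)]] by (auto simp: LCOSETS_def)

lemma lcosets_act_mult:
  assumes "subgroup H G" "v \<in> lcosets H" "g \<in> carrier G" "h \<in> carrier G"
  shows "(g \<otimes> h) <# v = g <# (h <# v)"
  using assms lcos_m_assoc lcosets_subset_PowG by (metis PowD in_mono)

lemma lcosets_act_one: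
  assumes "subgroup H G" "v \<in> lcosets H"
  shows "\<one> <# v = v"
  using assms lcos_mult_one lcosets_subset_PowG by (metis PowD in_mono)

lemma self_lcoset: "subgroup H G \<Longrightarrow> H \<in> lcosets H"
  using lcos_mult_one[OF subgroup.subset] by (force simp: LCOSETS_def)

lemma lcoset_eq:
  assumes "subgroup H G" "v \<in> lcosets H" "g \<in> v"
  shows "v = g <# H"
  using assms l_repr_independence by (auto simp: LCOSETS_def)

lemma lcoset_memD: "subgroup H G \<Longrightarrow> v \<in> lcosets H \<Longrightarrow> g \<in> v \<Longrightarrow> g \<in> carrier G"
  using lcosets_part_G by blast

end

locale coset_graph = group G for G (structure) +
  fixes S H :: "'a set" and t :: "'a set \<Rightarrow> 'a"
  assumes gens: "S \<subseteq> carrier G" "generate G S = carrier G"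
    and subgroup_H: "subgroup H G"
    and transversal: "v \<in> lcosets H \<Longrightarrow> t v \<in> v" and transversal_base: "t H = \<one>"
begin

abbreviation V where "V \<equiv> lcosets H"

text \<open>The Schreier cocycle: \<open>g \<otimes> t v = t (g <# v) \<otimes> cocycle g v\<close>.
  It lies in \<open>H\<close> because \<open>g \<otimes> t v\<close> and \<open>t (g <# v)\<close>
  represent the same coset \<open>g <# v\<close>.\<close>

definition cocycle :: "'a \<Rightarrow> 'a set \<Rightarrow> 'a" where
  "cocycle g v = inv (t (g <# v)) \<otimes> g \<otimes> t v"

definition edge_gen :: "'a set \<times> 'a \<Rightarrow> 'a" where
  "edge_gen e = cocycle (snd e) (fst e)"

text \<open>The edge (v, s) leads from v to s v. An inverse letter at v traverses backwards the edge
  that ends at v, which therefore starts at \<open>inv (fst l) <# v\<close>.\<close>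

definition letter_edge :: "'a \<times> bool \<Rightarrow> 'a set \<Rightarrow> 'a set \<times> 'a" where
  "letter_edge l v = (if snd l then inv (fst l) <# v else v, fst l)"

text \<open>Words act from the left, so a path reads its word from the right: the tail
  \<open>w\<close> is walked before the head letter is applied at
  \<open>word_eval G w <# v\<close>.\<close>

primrec path_edges :: "'a set \<Rightarrow> ('a \<times> bool) list \<Rightarrow> ('a set \<times> 'a) list" where
  "path_edges v [] = []"
| "path_edges v (l # w) = letter_edge l (word_eval G w <# v) # path_edges v w"

lemmas V_act = lcosets_act[OF subgroup_H]
lemmas V_act_mult = lcosets_act_mult[OF subgroup_H]
lemmas V_act_one = lcosets_act_one[OF subgroup_H]
lemmas H_in_V = self_lcoset[OF subgroup_H]

lemma V_act_inv:
  "v \<in> V \<Longrightarrow> g \<in> carrier G \<Longrightarrow> inv g <# (g <# v) = v"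
  "v \<in> V \<Longrightarrow> g \<in> carrier G \<Longrightarrow> g <# (inv g <# v) = v"
  using V_act_mult[of v "inv g" g] V_act_mult[of v g "inv g"] V_act_one by auto

lemma transversal_closed: "v \<in> V \<Longrightarrow> t v \<in> carrier G"
  using lcoset_memD[OF subgroup_H] transversal by blast

lemma cocycle_mult:
  assumes "g \<in> carrier G" "h \<in> carrier G" "v \<in> V"
  shows "cocycle (g \<otimes> h) v = cocycle g (h <# v) \<otimes> cocycle h v"
proof -
  have c: "t (g <# (h <# v)) \<in> carrier G" "t (h <# v) \<in> carrier G" "t v \<in> carrier G"
    using assms by (auto intro!: transversal_closed V_act)
  have "t (h <# v) \<otimes> (inv (t (h <# v)) \<otimes> (h \<otimes> t v)) = h \<otimes> t v"
    using c assms by (simp add: m_assoc[symmetric])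
  then show ?thesis
    using assms c by (simp add: cocycle_def V_act_mult m_assoc)
qed

lemma cocycle_one: "v \<in> V \<Longrightarrow> cocycle \<one> v = \<one>"
  by (simp add: cocycle_def V_act_one transversal_closed)

lemma cocycle_closed: "g \<in> carrier G \<Longrightarrow> v \<in> V \<Longrightarrow> cocycle g v \<in> carrier G"
  by (simp add: cocycle_def V_act transversal_closed)

lemma cocycle_inv:
  assumes "g \<in> carrier G" "v \<in> V"
  shows "cocycle (inv g) v = inv (cocycle g (inv g <# v))"
proof -
  have "cocycle g (inv g <# v) \<otimes> cocycle (inv g) v = \<one>"
    using cocycle_mult[of g "inv g" v] assms by (simp add: cocycle_one)
  then show ?thesis
    using assms inv_equality inv_inv
    by (metis cocycle_closed V_act inv_closed)
qed

lemma cocycle_base: "h \<in> H \<Longrightarrow> cocycle h H = h"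
  using subgroup.mem_carrier[OF subgroup_H]
  by (simp add: cocycle_def transversal_base coset_join3 subgroup_H)

lemma cocycle_in_H:
  assumes "g \<in> carrier G" "v \<in> V"
  shows "cocycle g v \<in> H"
proof -
  have gv: "g <# v \<in> V" using assms V_act by blast
  have "g \<otimes> t v \<in> g <# v"
    using transversal[OF assms(2)] by (auto simp: l_coset_def)
  also have "g <# v = t (g <# v) <# H"
    using lcoset_eq[OF subgroup_H gv transversal[OF gv]] .
  finally have "g \<otimes> t v \<in> t (g <# v) <# H" .
  then have "inv (t (g <# v)) \<otimes> (g \<otimes> t v) \<in> H"
    using subgroup.lcos_module_imp[OF subgroup_H is_group transversal_closed[OF gv]] by blast
  then show ?thesis
    using assms transversal_closed[OF gv] transversal_closed[OF assms(2)]
    by (simp add: cocycle_def m_assoc)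
qed

lemma edge_gen_in_H: "v \<in> V \<Longrightarrow> s \<in> S \<Longrightarrow> edge_gen (v, s) \<in> H"
  using gens by (auto simp: edge_gen_def cocycle_in_H)

lemma edge_gens_in_H: "E \<subseteq> V \<times> S \<Longrightarrow> edge_gen ` E \<subseteq> H"
  using edge_gen_in_H by auto

lemma letter_edge_closed:
  assumes "fst l \<in> S" "v \<in> V"
  shows "letter_edge l v \<in> V \<times> S"
  using assms gens by (auto simp: letter_edge_def V_act)

lemma cocycle_letter:
  assumes "fst l \<in> S" "v \<in> V"
  shows "cocycle (letter_value G l) v =
    (if snd l then inv (edge_gen (letter_edge l v)) else edge_gen (letter_edge l v))"
  using assms gens by (auto simp: letter_value_def letter_edge_def edge_gen_def cocycle_inv)

lemma cocycle_letter_generate: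
  assumes "fst l \<in> S" "v \<in> V" "letter_edge l v \<in> E"
  shows "cocycle (letter_value G l) v \<in> generate G (edge_gen ` E)"
  using assms by (auto simp: cocycle_letter intro: generate.incl generate.inv)

lemma path_edges_closed:
  assumes "w \<in> words_over S" "v \<in> V"
  shows "set (path_edges v w) \<subseteq> V \<times> S"
  using assms(1)
  by (induction w) (use assms(2) letter_edge_closed V_act word_eval_closed[OF gens(1)] in auto)

lemma cocycle_word_generate:
  assumes "w \<in> words_over S" "v \<in> V" "set (path_edges v w) \<subseteq> E"
  shows "cocycle (word_eval G w) v \<in> generate G (edge_gen ` E)"
  using assms(1,3)
proof (induction w)
  case Nil
  then show ?case by (simp add: cocycle_one assms(2) generate.one)
next
  case (Cons l w)
  have "word_eval G w \<in> carrier G" "letter_value G l \<in> carrier G"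
    using Cons word_eval_closed[OF gens(1)] gens by (auto intro: letter_value_closed)
  then show ?case
    using Cons assms(2)
    by (auto simp: word_eval_Cons cocycle_mult simp del: word_eval.simps(2)
        intro!: generate.eng cocycle_letter_generate V_act)
qed

text \<open>Schreier's lemma. Because \<open>t H = \<one>\<close>, an element of \<open>H\<close> is
  its own cocycle at the base vertex, and the cocycle of a word is a product of edge generators and
  inverses along its path.\<close>

lemma edge_gens_generate: "generate G (edge_gen ` (V \<times> S)) = H"
proof
  show "generate G (edge_gen ` (V \<times> S)) \<subseteq> H"
    using generate_subgroup_incl[OF edge_gens_in_H subgroup_H] by blast
  show "H \<subseteq> generate G (edge_gen ` (V \<times> S))"
  proof
    fix h assume h: "h \<in> H"
    then have "h \<in> generate G S"
      using gens subgroup.subset[OF subgroup_H] by blast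
    then obtain w where w: "w \<in> words_over S" "word_eval G w = h"
      using generate_word gens by metis
    then have "cocycle h H \<in> generate G (edge_gen ` (V \<times> S))"
      using cocycle_word_generate[OF w(1) H_in_V path_edges_closed[OF w(1) H_in_V]] by simp
    then show "h \<in> generate G (edge_gen ` (V \<times> S))"
      using h cocycle_base by simp
  qed
qed

end

lemma (in group) transversal_ex:
  assumes "subgroup H G"
  shows "\<exists>t. (\<forall>v \<in> lcosets H. t v \<in> v) \<and> t H = \<one>"
proof -
  have "\<exists>g. g \<in> v" if "v \<in> lcosets H" for v
    using that lcos_self[OF _ assms] by (auto simp: LCOSETS_def)
  then obtain t where "\<forall>v \<in> lcosets H. t v \<in> v" by metis
  then show ?thesis
    using subgroup.one_closed[OF assms] by (intro exI[of _ "t(H := \<one>)"]) auto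
qed

lemma (in group) coset_graph_ex:
  assumes "S \<subseteq> carrier G" "generate G S = carrier G" "subgroup H G"
  obtains t where "coset_graph G S H t"
  using transversal_ex[OF assms(3)] assms
  by (auto intro!: coset_graph.intro coset_graph_axioms.intro is_group)

section \<open>Splitting a finite index subgroup along its Schreier graph\<close>

text \<open>\<open>spanning\<close> records what is used of a spanning tree: each vertex is reached
  along edges with trivial generators. Since \<one> acts alike through both sides, the tree and the
  cover \<open>E\<close> can be chosen independently.\<close>

locale coset_splitting = coset_graph +
  fixes R :: "('a \<times> bool) list set" and E :: "bool \<Rightarrow> ('a set \<times> 'a) set"
  assumes relators: "R \<subseteq> words_over S" "r \<in> R \<Longrightarrow> word_eval G r = \<one>"
    and presentation: "w \<in> words_over S \<Longrightarrow> word_eval G w = \<one> \<Longrightarrow> consequence R w"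
    and cover: "E True \<union> E False = V \<times> S"
    and relator_edges: "r \<in> R \<Longrightarrow> v \<in> V \<Longrightarrow> \<exists>i. set (path_edges v r) \<subseteq> E i"
    and spanning: "v \<in> V \<Longrightarrow>
      \<exists>w \<in> words_over S. word_eval G w <# H = v \<and> (\<forall>e \<in> set (path_edges H w). edge_gen e = \<one>)"
begin

definition side :: "bool \<Rightarrow> 'a set" where
  "side i = generate G (edge_gen ` E i)"

definition common :: "'a set" where
  "common = generate G (edge_gen ` (E True \<inter> E False))"

lemma E_closed: "E i \<subseteq> V \<times> S"
  using cover by (cases i) auto

lemma edge_gens_closed: "edge_gen ` E i \<subseteq> carrier G"
  using edge_gens_in_H[OF E_closed] subgroup.subset[OF subgroup_H] by blast

sublocale amalgam_pair G side common
proof (intro amalgam_pair.intro amalgam_pair_axioms.intro is_group)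
  show "subgroup (side i) G" for i
    unfolding side_def using generate_is_subgroup edge_gens_closed by blast
  show "subgroup common G"
    unfolding common_def
    by (intro generate_is_subgroup subset_trans[OF image_mono edge_gens_closed[of True]]) simp
  show "common \<subseteq> side i" for i
    unfolding common_def side_def by (intro mono_generate image_mono) (cases i; auto)
qed

text \<open>The relation \<open>consequence\<close> may insert letters outside \<open>S\<close>, hence they must act, too: trivially.\<close>

definition letter_act ::
  "'a \<times> bool \<Rightarrow> 'a set \<times> 'a \<times> (bool \<times> 'a) list \<Rightarrow> 'a set \<times> 'a \<times> (bool \<times> 'a) list" where
  "letter_act l p = (if fst l \<in> S then (letter_value G l <# fst p,
     nf_act (letter_edge l (fst p) \<in> E True) (cocycle (letter_value G l) (fst p)) (snd p)) else p)"

abbreviation "word_act \<equiv> foldr letter_act"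

abbreviation "Z \<equiv> V \<times> normal_forms"

lemma letter_closed: "fst l \<in> S \<Longrightarrow> letter_value G l \<in> carrier G"
  using gens by (auto intro: letter_value_closed)

lemma letter_cocycle_side:
  "fst l \<in> S \<Longrightarrow> v \<in> V \<Longrightarrow> letter_edge l v \<in> E i \<Longrightarrow> cocycle (letter_value G l) v \<in> side i"
  unfolding side_def by (rule cocycle_letter_generate)

lemma letter_cocycle_common:
  "fst l \<in> S \<Longrightarrow> v \<in> V \<Longrightarrow> letter_edge l v \<in> E True \<Longrightarrow> letter_edge l v \<in> E False \<Longrightarrow>
    cocycle (letter_value G l) v \<in> common"
  unfolding common_def by (rule cocycle_letter_generate) auto

text \<open>For an edge in both sets \<open>letter_act\<close> uses side \<open>True\<close> by
  default. The choice is harmless: the cocycle then lies in \<open>common\<close>, on which both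
  actions agree.\<close>

lemma letter_act_side:
  assumes "fst l \<in> S" "v \<in> V" "\<omega> \<in> normal_forms" "letter_edge l v \<in> E i"
  shows "letter_act l (v, \<omega>) = (letter_value G l <# v, nf_act i (cocycle (letter_value G l) v) \<omega>)"
proof (cases "letter_edge l v \<in> E True = i")
  case True
  then show ?thesis using assms by (simp add: letter_act_def)
next
  case False
  then have "cocycle (letter_value G l) v \<in> common"
    using assms by (intro letter_cocycle_common) (cases i; auto)+
  then show ?thesis
    using assms by (simp add: letter_act_def nf_act_C)
qed

lemma some_side: "e \<in> V \<times> S \<Longrightarrow> \<exists>i. e \<in> E i"
  using cover by blast

lemma letter_act_closed:
  assumes "p \<in> Z"
  shows "letter_act l p \<in> Z"
proof (cases "fst l \<in> S")
  case True
  obtain v \<omega> where v: "p = (v, \<omega>)" "v \<in> V" "\<omega> \<in> normal_forms"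
    using assms by auto
  obtain i where "letter_edge l v \<in> E i"
    using some_side[OF letter_edge_closed[OF True v(2)]] by blast
  then show ?thesis
    unfolding v(1) letter_act_side[OF True v(2,3) \<open>letter_edge l v \<in> E i\<close>]
    using V_act[OF v(2) letter_closed[OF True]]
      nf_act_closed[OF letter_cocycle_side[OF True v(2)] v(3)] by blast
qed (use assms in \<open>simp add: letter_act_def\<close>)

lemma letter_act_inv:
  assumes "p \<in> Z"
  shows "letter_act (inv_letter l) (letter_act l p) = p"
proof (cases "fst l \<in> S")
  case True
  obtain v \<omega> where v: "p = (v, \<omega>)" "v \<in> V" "\<omega> \<in> normal_forms" using assms by auto
  let ?g = "letter_value G l"
  have g: "?g \<in> carrier G" by (rule letter_closed[OF True])
  have gv: "?g <# v \<in> V" using V_act v g by blast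
  have l: "fst l \<in> carrier G" using True gens by auto
  obtain i where i: "letter_edge l v \<in> E i"
    using some_side[OF letter_edge_closed[OF True v(2)]] by blast
  have gi: "letter_value G (inv_letter l) = inv ?g"
    using letter_value_inv_letter[OF l] .
  \<comment> \<open>The inverse letter runs back along the same edge, so one side i serves both
    letters and the two cocycles multiply to \<one> inside it.\<close>
  have e: "letter_edge (inv_letter l) (?g <# v) = letter_edge l v"
    using l v(2) by (cases "snd l") (simp_all add: letter_edge_def inv_letter_def letter_value_def V_act_inv)
  have c1: "cocycle ?g v \<in> side i"
    using letter_cocycle_side[OF True v(2) i] .
  have c2: "cocycle (inv ?g) (?g <# v) \<in> side i"
    using letter_cocycle_side[of "inv_letter l" "?g <# v" i] True gv i unfolding gi e by simp
  have "letter_act (inv_letter l) (?g <# v, nf_act i (cocycle ?g v) \<omega>) =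
      (inv ?g <# (?g <# v), nf_act i (cocycle (inv ?g) (?g <# v)) (nf_act i (cocycle ?g v) \<omega>))"
    using letter_act_side[of "inv_letter l" "?g <# v" "nf_act i (cocycle ?g v) \<omega>" i]
      True gv i nf_act_closed[OF c1 v(3)] unfolding gi e by simp
  then have "letter_act (inv_letter l) (letter_act l p) =
      (inv ?g <# (?g <# v), nf_act i (cocycle (inv ?g) (?g <# v)) (nf_act i (cocycle ?g v) \<omega>))"
    unfolding v(1) letter_act_side[OF True v(2,3) i] .
  also have "cocycle (inv ?g) (?g <# v) \<otimes> cocycle ?g v = \<one>"
    using cocycle_mult[of "inv ?g" ?g v] g v(2) by (simp add: cocycle_one)
  then have "nf_act i (cocycle (inv ?g) (?g <# v)) (nf_act i (cocycle ?g v) \<omega>) = \<omega>"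
    using nf_act_mult[OF c2 c1 v(3)] nf_act_one[OF v(3)] by simp
  also have "inv ?g <# (?g <# v) = v"
    using V_act_inv v(2) g by blast
  also have "(v, \<omega>) = p"
    using v by simp
  finally show ?thesis .
qed (simp add: letter_act_def)

lemma word_act_closed:
  assumes "p \<in> Z"
  shows "word_act w p \<in> Z"
proof (induction w)
  case Nil
  then show ?case using assms by simp
next
  case (Cons l w)
  show ?case using letter_act_closed[OF Cons, of l] by simp
qed

lemma word_act_inv:
  assumes "p \<in> Z"
  shows "word_act (inv_word w) (word_act w p) = p"
proof (induction w)
  case (Cons l w)
  show ?case
    using Cons letter_act_inv[OF word_act_closed[OF assms], of l w] by simp
qed simp

lemma word_act_side:
  assumes "w \<in> words_over S" "v \<in> V" "\<omega> \<in> normal_forms" "set (path_edges v w) \<subseteq> E i"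
  shows "word_act w (v, \<omega>) = (word_eval G w <# v, nf_act i (cocycle (word_eval G w) v) \<omega>)"
  using assms(1,4)
proof (induction w)
  case Nil
  then show ?case using assms by (simp add: V_act_one cocycle_one nf_act_one)
next
  case (Cons l w)
  have w: "word_eval G w \<in> carrier G" using word_eval_closed[OF gens(1)] Cons by auto
  have l: "fst l \<in> S" "letter_value G l \<in> carrier G" using Cons letter_closed by auto
  have s: "cocycle (word_eval G w) v \<in> side i"
    unfolding side_def using Cons assms by (intro cocycle_word_generate) auto
  have sl: "cocycle (letter_value G l) (word_eval G w <# v) \<in> side i"
    using Cons l w assms by (intro letter_cocycle_side V_act) auto
  have "word_act (l # w) (v, \<omega>) =
      letter_act l (word_eval G w <# v, nf_act i (cocycle (word_eval G w) v) \<omega>)"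
    using Cons by simp
  also have "\<dots> = (letter_value G l <# (word_eval G w <# v),
      nf_act i (cocycle (letter_value G l) (word_eval G w <# v))
        (nf_act i (cocycle (word_eval G w) v) \<omega>))"
    using Cons l w assms s by (intro letter_act_side nf_act_closed V_act) auto
  also have "\<dots> = (word_eval G (l # w) <# v, nf_act i (cocycle (word_eval G (l # w)) v) \<omega>)"
    using l w assms s sl
    by (simp add: word_eval_Cons V_act_mult cocycle_mult nf_act_mult del: word_eval.simps(2))
  finally show ?case .
qed

text \<open>The assumption \<open>relator_edges\<close> enters here: the loop of a relator lies in
  one side, hence acts through its cocycle, and the cocycle of the value \<one> is \<one>.\<close>

lemma relator_act:
  assumes "r \<in> R" "p \<in> Z"
  shows "word_act r p = p"
proof -
  obtain v \<omega> where p: "p = (v, \<omega>)" "v \<in> V" "\<omega> \<in> normal_forms" using assms by auto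
  obtain i where "set (path_edges v r) \<subseteq> E i"
    using relator_edges[OF assms(1) p(2)] by blast
  then show ?thesis
    using word_act_side[of r v \<omega> i] p assms relators
    by (auto simp: V_act_one cocycle_one nf_act_one)
qed

lemma consequence_act:
  assumes "consequence R w"
  shows "p \<in> Z \<Longrightarrow> word_act w p = p"
  using assms
proof (induction w arbitrary: p rule: consequence.induct)
  case empty
  show ?case by simp
next
  case (ins_pair u v l p)
  have "letter_act l (letter_act (inv_letter l) (word_act v p)) = word_act v p"
    using letter_act_inv[OF word_act_closed[OF ins_pair.prems], of "inv_letter l"] by simp
  then show ?case
    using ins_pair.IH[OF ins_pair.prems] by simp
next
  case (del_pair u l v p)
  have "letter_act l (letter_act (inv_letter l) (word_act v p)) = word_act v p"
    using letter_act_inv[OF word_act_closed[OF del_pair.prems], of "inv_letter l"] by simp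
  then show ?case
    using del_pair.IH[OF del_pair.prems] by simp
next
  case (ins_rel r u v p)
  show ?case
    using ins_rel.IH[OF ins_rel.prems]
      relator_act[OF ins_rel.hyps(1) word_act_closed[OF ins_rel.prems]] by simp
next
  case (ins_rel_inv r u v p)
  have "word_act (inv_word r) (word_act v p) = word_act v p"
    using word_act_inv[OF word_act_closed[OF ins_rel_inv.prems], of r v]
      relator_act[OF ins_rel_inv.hyps(1) word_act_closed[OF ins_rel_inv.prems]] by simp
  then show ?case
    using ins_rel_inv.IH[OF ins_rel_inv.prems] by simp
qed

text \<open>This turns the action of words into an action of the group: by the presentation, words
  of equal value differ by a consequence of the relators, which acts trivially on
  \<open>Z\<close>.\<close>

lemma word_act_cong:
  assumes "u \<in> words_over S" "w \<in> words_over S" "word_eval G u = word_eval G w" "p \<in> Z"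
  shows "word_act u p = word_act w p"
proof -
  have "word_eval G (inv_word w @ u) = \<one>"
    using assms word_eval_closed[OF gens(1)]
    by (simp add: word_eval_append[OF gens(1)] word_eval_inv_word[OF gens(1)])
  then have "consequence R (inv_word w @ u)"
    using assms by (intro presentation) auto
  then have 1: "word_act (inv_word w) (word_act u p) = p"
    using consequence_act[OF _ assms(4)] by (metis foldr_append comp_apply)
  have "word_eval G (w @ inv_word w) = \<one>"
    using assms word_eval_closed[OF gens(1)]
    by (simp add: word_eval_append[OF gens(1)] word_eval_inv_word[OF gens(1)])
  then have "consequence R (w @ inv_word w)"
    using assms by (intro presentation) auto
  then have "word_act w (word_act (inv_word w) (word_act u p)) = word_act u p"
    using consequence_act[OF _ word_act_closed[OF assms(4), of u]] by (metis foldr_append comp_apply)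
  then show ?thesis using 1 by simp
qed

text \<open>Tree edges change the vertex but not the normal form, so a tree path identifies the
  fibre over \<open>H\<close> with the fibre over \<open>v\<close>. Its cocycle is a product of
  trivial generators, and with \<open>t H = \<one>\<close> this forces its value to be
  \<open>t v\<close>.\<close>

lemma spanning_act:
  assumes "v \<in> V"
  obtains w where "w \<in> words_over S" "word_eval G w = t v"
    "\<And>\<omega>. \<omega> \<in> normal_forms \<Longrightarrow> word_act w (H, \<omega>) = (v, \<omega>)"
proof -
  have *: "word_act w (H, \<omega>) = (word_eval G w <# H, \<omega>)"
    if "w \<in> words_over S" "\<forall>e \<in> set (path_edges H w). edge_gen e = \<one>" "\<omega> \<in> normal_forms" for w \<omega>
    using that
  proof (induction w)
    case Nil
    then show ?case using H_in_V by (simp add: V_act_one)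
  next
    case (Cons l w)
    have w: "word_eval G w \<in> carrier G" using word_eval_closed[OF gens(1)] Cons by auto
    have l: "fst l \<in> S" "letter_value G l \<in> carrier G" using Cons letter_closed by auto
    have v: "word_eval G w <# H \<in> V" using w V_act H_in_V by blast
    have "cocycle (letter_value G l) (word_eval G w <# H) = \<one>"
      using Cons l v by (simp add: cocycle_letter)
    then have "letter_act l (word_eval G w <# H, \<omega>) = (letter_value G l <# (word_eval G w <# H), \<omega>)"
      using l Cons by (simp add: letter_act_def nf_act_one)
    then show ?case
      using Cons l w by (simp add: word_eval_Cons V_act_mult H_in_V del: word_eval.simps(2))
  qed
  obtain w where w: "w \<in> words_over S" "word_eval G w <# H = v"
    "\<forall>e \<in> set (path_edges H w). edge_gen e = \<one>"
    using spanning[OF assms] by blast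
  have "cocycle (word_eval G w) H \<in> generate G (edge_gen ` set (path_edges H w))"
    using cocycle_word_generate[OF w(1) H_in_V] by blast
  also have "\<dots> \<subseteq> generate G {\<one>}"
    using w(3) by (intro mono_generate) auto
  finally have "cocycle (word_eval G w) H = \<one>"
    using generate_one by blast
  then have "inv (t v) \<otimes> word_eval G w = \<one>"
    using w word_eval_closed[OF gens(1)] assms
    by (simp add: cocycle_def transversal_base transversal_closed)
  then have "word_eval G w = t v"
    using w word_eval_closed[OF gens(1)] assms transversal_closed
    by (metis inv_closed inv_equality inv_inv)
  then show ?thesis
    using that w * by metis
qed

section \<open>The action of the sides on the fibre over the base vertex\<close>

lemma letter_act_edge:
  assumes "(v, s) \<in> E i" "\<omega> \<in> normal_forms"
  shows "letter_act (s, False) (v, \<omega>) = (s <# v, nf_act i (edge_gen (v, s)) \<omega>)"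
proof -
  have "s \<in> S" "v \<in> V" using E_closed[of i] assms(1) by auto
  then show ?thesis
    using letter_act_side[of "(s, False)" v \<omega> i] assms
    by (simp add: letter_edge_def letter_value_def edge_gen_def)
qed

text \<open>Elements of \<open>H\<close> fix the base vertex and act on the fibre over it through
  any word that represents them; the predicate compares this action with \<open>nf_act\<close>.
  Quantifying over all words makes it convenient to use, while by \<open>word_act_cong\<close> one
  word suffices to prove it.\<close>

definition fibre_act :: "bool \<Rightarrow> 'a \<Rightarrow> bool" where
  "fibre_act i a \<longleftrightarrow> (\<forall>w \<in> words_over S. \<forall>\<omega> \<in> normal_forms.
     word_eval G w = a \<longrightarrow> word_act w (H, \<omega>) = (H, nf_act i a \<omega>))"

lemma fibre_actI:
  assumes "w \<in> words_over S" "word_eval G w = a"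
    and "\<And>\<omega>. \<omega> \<in> normal_forms \<Longrightarrow> word_act w (H, \<omega>) = (H, nf_act i a \<omega>)"
  shows "fibre_act i a"
  unfolding fibre_act_def
proof (intro ballI impI)
  fix u \<omega> assume u: "u \<in> words_over S" "\<omega> \<in> normal_forms" "word_eval G u = a"
  then have "word_act u (H, \<omega>) = word_act w (H, \<omega>)"
    using assms(1,2) H_in_V by (intro word_act_cong) auto
  then show "word_act u (H, \<omega>) = (H, nf_act i a \<omega>)"
    using assms(3) u(2) by simp
qed

text \<open>Read from the right, the word goes out to \<open>v\<close> along the tree, crosses the
  edge, and returns from \<open>s <# v\<close> along the tree. Its value is the edge generator, and
  only the crossing changes the normal form.\<close>

lemma fibre_act_edge_gen:
  assumes "(v, s) \<in> E i"
  shows "fibre_act i (edge_gen (v, s))"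
proof -
  have vs: "v \<in> V" "s \<in> S" "s \<in> carrier G" using E_closed assms gens by auto
  have sv: "s <# v \<in> V" using vs V_act by blast
  obtain w where w: "w \<in> words_over S" "word_eval G w = t v"
    "\<And>\<omega>. \<omega> \<in> normal_forms \<Longrightarrow> word_act w (H, \<omega>) = (v, \<omega>)"
    using spanning_act[OF vs(1)] by blast
  obtain u where u: "u \<in> words_over S" "word_eval G u = t (s <# v)"
    "\<And>\<omega>. \<omega> \<in> normal_forms \<Longrightarrow> word_act u (H, \<omega>) = (s <# v, \<omega>)"
    using spanning_act[OF sv] by blast
  have u': "word_act (inv_word u) (s <# v, \<omega>) = (H, \<omega>)" if "\<omega> \<in> normal_forms" for \<omega>
    using word_act_inv[of "(H, \<omega>)" u] u(3) H_in_V that by auto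
  have e: "edge_gen (v, s) \<in> side i" using assms unfolding side_def by (auto intro: generate.incl)
  show ?thesis
  proof (rule fibre_actI)
    show "inv_word u @ (s, False) # w \<in> words_over S" using u w vs by simp
    show "word_eval G (inv_word u @ (s, False) # w) = edge_gen (v, s)"
      using u w vs sv transversal_closed
      by (simp add: word_eval_append[OF gens(1)] word_eval_inv_word[OF gens(1)] edge_gen_def
          cocycle_def m_assoc)
    show "word_act (inv_word u @ (s, False) # w) (H, \<omega>) = (H, nf_act i (edge_gen (v, s)) \<omega>)"
      if "\<omega> \<in> normal_forms" for \<omega>
      using that w(3) u' e assms by (simp add: letter_act_edge nf_act_closed)
  qed
qed

lemma fibre_act_inv:
  assumes "fibre_act i a" "a \<in> side i"
  shows "fibre_act i (inv a)"
proof -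
  obtain w where w: "w \<in> words_over S" "word_eval G w = a"
    using generate_word gens A_carrier[OF assms(2)] by metis
  show ?thesis
  proof (rule fibre_actI)
    show "inv_word w \<in> words_over S" "word_eval G (inv_word w) = inv a"
      using w by (simp_all add: word_eval_inv_word[OF gens(1)])
    fix \<omega> assume o: "\<omega> \<in> normal_forms"
    then have o': "nf_act i (inv a) \<omega> \<in> normal_forms" using assms A_inv nf_act_closed by blast
    have "word_act w (H, nf_act i (inv a) \<omega>) = (H, nf_act i a (nf_act i (inv a) \<omega>))"
      using assms(1) w o' by (simp add: fibre_act_def)
    also have "nf_act i a (nf_act i (inv a) \<omega>) = \<omega>"
      using o assms A_inv A_carrier by (simp add: nf_act_mult[symmetric] nf_act_one)
    finally show "word_act (inv_word w) (H, \<omega>) = (H, nf_act i (inv a) \<omega>)"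
      using word_act_inv[of "(H, nf_act i (inv a) \<omega>)" w] o' H_in_V by simp
  qed
qed

lemma fibre_act_mult:
  assumes "fibre_act i a" "a \<in> side i" "fibre_act i b" "b \<in> side i"
  shows "fibre_act i (a \<otimes> b)"
proof -
  obtain u where u: "u \<in> words_over S" "word_eval G u = a"
    using generate_word gens A_carrier[OF assms(2)] by metis
  obtain w where w: "w \<in> words_over S" "word_eval G w = b"
    using generate_word gens A_carrier[OF assms(4)] by metis
  show ?thesis
  proof (rule fibre_actI)
    show "u @ w \<in> words_over S" "word_eval G (u @ w) = a \<otimes> b"
      using u w by (simp_all add: word_eval_append[OF gens(1)])
    show "word_act (u @ w) (H, \<omega>) = (H, nf_act i (a \<otimes> b) \<omega>)" if "\<omega> \<in> normal_forms" for \<omega>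
      using that u w assms by (simp add: fibre_act_def nf_act_closed nf_act_mult)
  qed
qed

lemma fibre_act_side:
  assumes "a \<in> side i"
  shows "fibre_act i a"
proof -
  have "a \<in> side i \<and> fibre_act i a"
    using assms unfolding side_def
  proof induction
    case one
    show ?case unfolding side_def[symmetric]
      using subgroup.one_closed[OF subgroup_A]
      by (auto intro!: fibre_actI[of "[]"] simp: nf_act_one)
  next
    case (incl h)
    then show ?case unfolding side_def[symmetric]
      using fibre_act_edge_gen by (auto simp: side_def intro: generate.incl)
  next
    case (inv h)
    then have "h \<in> side i" "fibre_act i h"
      using fibre_act_edge_gen by (auto simp: side_def intro: generate.incl)
    then show ?case unfolding side_def[symmetric]
      using fibre_act_inv A_inv by blast
  next
    case (eng h1 h2)
    then show ?case unfolding side_def[symmetric]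
      using fibre_act_mult A_m by blast
  qed
  then show ?thesis ..
qed

section \<open>Recognising the amalgam\<close>

lemma alternating_act_word:
  assumes "alternating ps"
  shows "\<exists>w \<in> words_over S. word_eval G w = foldr (\<otimes>) (map snd ps) \<one> \<and>
    word_act w (H, base_form) = (H, foldr (\<lambda>(i, a). nf_act i a) ps base_form)"
  using assms
proof (induction ps)
  case Nil
  then show ?case by (intro bexI[of _ "[]"]) auto
next
  case (Cons p ps)
  obtain i a where p: "p = (i, a)" by force
  then have a: "a \<in> side i" "alternating ps" using Cons by auto
  obtain w where w: "w \<in> words_over S" "word_eval G w = foldr (\<otimes>) (map snd ps) \<one>"
    "word_act w (H, base_form) = (H, foldr (\<lambda>(i, a). nf_act i a) ps base_form)"
    using Cons a by blast
  obtain u where u: "u \<in> words_over S" "word_eval G u = a"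
    using generate_word gens A_carrier[OF a(1)] by metis
  have "word_act u (H, foldr (\<lambda>(i, a). nf_act i a) ps base_form) =
      (H, nf_act i a (foldr (\<lambda>(i, a). nf_act i a) ps base_form))"
    using fibre_act_side[OF a(1)] u alternating_act[OF a(2)] by (simp add: fibre_act_def)
  then show ?case
    using u w by (intro bexI[of _ "u @ w"]) (simp_all add: p word_eval_append[OF gens(1)])
qed

text \<open>A product equal to \<one> is represented by a word that acts trivially, whereas applied
  to the base form it produces a tail as long as \<open>ps\<close>.\<close>

lemma alternating_nontrivial:
  assumes "alternating ps" "ps \<noteq> []"
  shows "foldr (\<otimes>) (map snd ps) \<one> \<noteq> \<one>"
proof
  assume 1: "foldr (\<otimes>) (map snd ps) \<one> = \<one>"
  obtain w where w: "w \<in> words_over S" "word_eval G w = \<one>"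
    "word_act w (H, base_form) = (H, foldr (\<lambda>(i, a). nf_act i a) ps base_form)"
    using alternating_act_word[OF assms(1)] 1 by auto
  then have "word_act w (H, base_form) = (H, base_form)"
    using consequence_act presentation H_in_V by simp
  then show False
    using w(3) alternating_act[OF assms(1)] assms(2) by (simp add: base_form_def)
qed

text \<open>An element g of both sides outside \<open>common\<close> could be tagged either way, and
  then g followed by its inverse would be an alternating product equal to \<one>.\<close>

lemma side_Int: "side True \<inter> side False = common"
proof
  show "common \<subseteq> side True \<inter> side False" using C_le by blast
  show "side True \<inter> side False \<subseteq> common"
  proof (rule ccontr)
    assume "\<not> ?thesis"
    then obtain g where g: "g \<in> side True" "g \<in> side False" "g \<notin> common" by blast
    have "inv g \<notin> common"
      using g(3) C_inv[of "inv g"] A_carrier[OF g(1)] by auto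
    then have "alternating [(True, g), (False, inv g)]"
      using g A_inv by auto
    from alternating_nontrivial[OF this] show False
      using A_carrier[OF g(1)] by simp
  qed
qed

lemma side_le_H: "side i \<subseteq> H"
  unfolding side_def by (rule generate_subgroup_incl[OF edge_gens_in_H[OF E_closed] subgroup_H])

lemma sides_generate: "generate G (side True \<union> side False) = H"
proof
  show "generate G (side True \<union> side False) \<subseteq> H"
    by (intro generate_subgroup_incl subgroup_H Un_least side_le_H)
  have *: "edge_gen e \<in> side i" if "e \<in> E i" for e i
    using that unfolding side_def by (auto intro: generate.incl)
  have "edge_gen ` (V \<times> S) \<subseteq> side True \<union> side False"
  proof
    fix x assume "x \<in> edge_gen ` (V \<times> S)"
    then obtain e where e: "x = edge_gen e" "e \<in> V \<times> S" by blast
    obtain i where "e \<in> E i" using some_side[OF e(2)] ..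
    then show "x \<in> side True \<union> side False"
      using *[of e i] e(1) by (cases i) auto
  qed
  then show "H \<subseteq> generate G (side True \<union> side False)"
    using mono_generate edge_gens_generate by blast
qed

lemma reduced_alternating_tags:
  assumes "reduced_alternating (side True) (side False) gs"
  shows "alternating (map (\<lambda>g. (g \<in> side True, g)) gs)"
  using assms
proof (induction gs)
  case (Cons g gs)
  have mem: "x \<in> side (x \<in> side True) \<and> x \<notin> common" if "x \<in> set (g # gs)" for x
    using that Cons.prems side_Int unfolding reduced_alternating_def by (cases "x \<in> side True") auto
  have alt: "((g # gs) ! i \<in> side True) \<longleftrightarrow> ((g # gs) ! Suc i \<notin> side True)"
    if "Suc i < length (g # gs)" for i
    using that Cons.prems unfolding reduced_alternating_def by blast
  show ?case
  proof (cases gs)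
    case Nil
    then show ?thesis using mem[of g] by simp
  next
    case (Cons h hs)
    have "reduced_alternating (side True) (side False) gs"
      unfolding reduced_alternating_def
    proof (intro conjI ballI allI impI)
      show "gs \<noteq> []" using Cons by simp
      show "x \<in> side True \<union> side False - side True \<inter> side False" if "x \<in> set gs" for x
        using that Cons.prems unfolding reduced_alternating_def by simp
      show "(gs ! i \<in> side True) = (gs ! Suc i \<notin> side True)" if "Suc i < length gs" for i
        using alt[of "Suc i"] that by simp
    qed
    then show ?thesis
      using Cons.IH mem[of g] alt[of 0] Cons by simp
  qed
qed simp

proposition amalgamated_product: "is_amalgamated_product G H (side True) (side False)"
  unfolding is_amalgamated_product_def
proof (intro conjI allI impI)
  show "subgroup (side True) G" "subgroup (side False) G" by (rule subgroup_A)+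
  show "side True \<subseteq> H" "side False \<subseteq> H"
    by (rule side_le_H)+
  show "generate G (side True \<union> side False) = H" by (rule sides_generate)
  fix gs assume gs: "reduced_alternating (side True) (side False) gs"
  have "map snd (map (\<lambda>g. (g \<in> side True, g)) gs) = gs" by (induction gs) auto
  then show "foldr (\<otimes>) gs \<one> \<noteq> \<one>"
    using alternating_nontrivial[OF reduced_alternating_tags[OF gs]] gs
    by (auto simp: reduced_alternating_def)
qed

end

section \<open>Spanning trees and the rank bound\<close>

lemma min_gens_le:
  assumes "A \<subseteq> H" "finite A" "generate G A = H"
  shows "min_gens G H \<le> card A"
  unfolding min_gens_def by (rule Least_le) (use assms in blast)

context group
begin

text \<open>Breadth-first search: \<open>d\<close> is the distance from \<open>H\<close>,
  \<open>pu\<close> and \<open>pl\<close> choose a parent and the letter leading from it, and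
  \<open>tw v\<close> is the resulting path from \<open>H\<close> to \<open>v\<close>. Taking its
  value as \<open>t v\<close> makes the generators of all tree edges trivial.\<close>

lemma spanning_tree_ex:
  assumes S: "S \<subseteq> carrier G" "generate G S = carrier G" and H: "subgroup H G"
  obtains t where "coset_graph G S H t"
    and "\<And>v. v \<in> lcosets H \<Longrightarrow> \<exists>w \<in> words_over S. word_eval G w <# H = v \<and>
      (\<forall>e \<in> set (coset_graph.path_edges G H w). coset_graph.edge_gen G t e = \<one>)"
proof -
  let ?V = "lcosets H"
  define reach where "reach n v \<longleftrightarrow> (\<exists>w \<in> words_over S. length w = n \<and> word_eval G w <# H = v)" for n v
  define d where "d v = (LEAST n. reach n v)" for v
  have reach_ex: "\<exists>n. reach n v" if v: "v \<in> ?V" for v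
  proof -
    obtain g where g: "g \<in> carrier G" "v = g <# H" using v by (auto simp: LCOSETS_def)
    obtain w where "w \<in> words_over S" "word_eval G w = g" using generate_word S g by metis
    then show ?thesis using g by (auto simp: reach_def)
  qed
  have reach_d: "reach (d v) v" if "v \<in> ?V" for v
    unfolding d_def using reach_ex[OF that] by (rule LeastI_ex)
  have d_le: "d v \<le> n" if "reach n v" for v n
    unfolding d_def using that by (rule Least_le)
  have H_V: "H \<in> ?V" using self_lcoset[OF H] .
  have d0: "v = H" if "v \<in> ?V" "d v = 0" for v
    using reach_d[OF that(1)] that(2) lcosets_act_one[OF H H_V] by (auto simp: reach_def)
  have dH: "d H = 0"
    using d_le[of 0 H] lcosets_act_one[OF H H_V] by (auto simp: reach_def)
  have step: "\<exists>l u. fst l \<in> S \<and> u \<in> ?V \<and> letter_value G l <# u = v \<and> d v = Suc (d u)"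
    if v: "v \<in> ?V" "v \<noteq> H" for v
  proof -
    obtain w where w: "w \<in> words_over S" "length w = d v" "word_eval G w <# H = v"
      using reach_d[OF v(1)] by (auto simp: reach_def)
    have "w \<noteq> []" using w d0[OF v(1)] v(2) by (metis length_0_conv)
    then obtain l w' where lw: "w = l # w'" by (cases w) auto
    have l: "letter_value G l \<in> carrier G" "fst l \<in> S"
      using w lw S by (auto intro: letter_value_closed)
    have w': "w' \<in> words_over S" "word_eval G w' \<in> carrier G"
      using w lw word_eval_closed[OF S(1)] by auto
    let ?u = "word_eval G w' <# H"
    have u: "?u \<in> ?V" using lcosets_act[OF H H_V] w' by blast
    have lu: "letter_value G l <# ?u = v"
      using w lw l w' lcosets_act_mult[OF H H_V] by (simp add: word_eval_Cons del: word_eval.simps(2))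
    have "d ?u \<le> length w'" by (rule d_le) (use w' in \<open>auto simp: reach_def\<close>)
    moreover have "d v \<le> Suc (d ?u)"
    proof (rule d_le)
      obtain x where x: "x \<in> words_over S" "length x = d ?u" "word_eval G x <# H = ?u"
        using reach_d[OF u] by (auto simp: reach_def)
      have "word_eval G (l # x) <# H = v"
        using x l lu lcosets_act_mult[OF H H_V, of "letter_value G l" "word_eval G x"]
          word_eval_closed[OF S(1) x(1)] by (simp add: word_eval_Cons del: word_eval.simps(2))
      then show "reach (Suc (d ?u)) v"
        using x l unfolding reach_def by (intro bexI[of _ "l # x"]) auto
    qed
    ultimately have "d v = Suc (d ?u)" using w lw by simp
    then show ?thesis using l u lu by blast
  qed
  then obtain pl pu where p: "\<And>v. v \<in> ?V \<Longrightarrow> v \<noteq> H \<Longrightarrow> fst (pl v) \<in> S \<and> pu v \<in> ?V \<and>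
      letter_value G (pl v) <# pu v = v \<and> d v = Suc (d (pu v))"
    by metis
  \<comment> \<open>Recursion on the number of steps: \<open>W n v\<close> collects the letters on
    the way from \<open>v\<close> up through n parents, and n = \<open>d v\<close> ends at
    \<open>H\<close>.\<close>
  define W where "W = rec_nat (\<lambda>v. []) (\<lambda>n f v. pl v # f (pu v))"
  define tw where "tw v = W (d v) v" for v
  have tw_H: "tw H = []" by (simp add: tw_def dH W_def)
  have tw_step: "tw v = pl v # tw (pu v)" if "v \<in> ?V" "v \<noteq> H" for v
    using p[OF that] by (simp add: tw_def W_def)
  have V_induct: "P v" if "v \<in> ?V" "P H" "\<And>v. v \<in> ?V \<Longrightarrow> v \<noteq> H \<Longrightarrow> P (pu v) \<Longrightarrow> P v" for P v
    using that(1)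
  proof (induction "d v" arbitrary: v rule: less_induct)
    case less
    then show ?case using p[of v] that(2,3) by (cases "v = H") auto
  qed
  have tw: "tw v \<in> words_over S \<and> word_eval G (tw v) <# H = v" if "v \<in> ?V" for v
    using that
  proof (rule V_induct)
    show "tw H \<in> words_over S \<and> word_eval G (tw H) <# H = H"
      using lcosets_act_one[OF H H_V] by (simp add: tw_H)
    fix v assume v: "v \<in> ?V" "v \<noteq> H" and IH: "tw (pu v) \<in> words_over S \<and> word_eval G (tw (pu v)) <# H = pu v"
    have "letter_value G (pl v) \<in> carrier G" using p[OF v] S by (auto intro: letter_value_closed)
    then show "tw v \<in> words_over S \<and> word_eval G (tw v) <# H = v"
      using IH p[OF v] tw_step[OF v] word_eval_closed[OF S(1)] lcosets_act_mult[OF H H_V]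
      by (simp add: word_eval_Cons del: word_eval.simps(2))
  qed
  define t where "t v = word_eval G (tw v)" for v
  have "t v \<in> v" if "v \<in> ?V" for v
    using tw[OF that] word_eval_closed[OF S(1)] lcos_self[OF _ H] unfolding t_def by metis
  then interpret cg: coset_graph G S H t
    using S H by unfold_locales (simp_all add: subgroup_def t_def tw_H)
  have "\<forall>e \<in> set (cg.path_edges H (tw v)). cg.edge_gen e = \<one>" if "v \<in> ?V" for v
    using that
  proof (rule V_induct)
    show "\<forall>e \<in> set (cg.path_edges H (tw H)). cg.edge_gen e = \<one>" by (simp add: tw_H)
    fix v assume v: "v \<in> ?V" "v \<noteq> H"
      and IH: "\<forall>e \<in> set (cg.path_edges H (tw (pu v))). cg.edge_gen e = \<one>"
    let ?l = "pl v" and ?u = "pu v"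
    have l: "letter_value G ?l \<in> carrier G" using p[OF v] S by (auto intro: letter_value_closed)
    have tu: "t ?u \<in> carrier G" using cg.transversal_closed p[OF v] by blast
    \<comment> \<open>This says that \<open>t\<close> is equivariant along the tree edge, which is
      what a trivial cocycle means; for an inverse letter the edge generator is the inverse of that
      cocycle.\<close>
    have "t v = letter_value G ?l \<otimes> t ?u"
      using tw_step[OF v] by (simp add: t_def word_eval_Cons del: word_eval.simps(2))
    then have "cg.cocycle (letter_value G ?l) ?u = \<one>"
      using p[OF v] l tu by (simp add: cg.cocycle_def m_assoc)
    moreover have "cg.edge_gen (cg.letter_edge ?l ?u) \<in> carrier G"
      using cg.edge_gens_in_H[of "{cg.letter_edge ?l ?u}"] cg.letter_edge_closed p[OF v]
        subgroup.subset[OF H] by auto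
    ultimately have "cg.edge_gen (cg.letter_edge ?l ?u) = \<one>"
      using cg.cocycle_letter[of ?l ?u] p[OF v] by (auto split: if_splits simp: inv_eq_1_iff)
    moreover have "word_eval G (tw ?u) <# H = ?u" using tw p[OF v] by blast
    ultimately show "\<forall>e \<in> set (cg.path_edges H (tw v)). cg.edge_gen e = \<one>"
      using IH tw_step[OF v] by simp
  qed
  then show ?thesis
    using that[OF cg.coset_graph_axioms] tw by blast
qed

text \<open>The index is 1 or 2. In the second case any element of \<open>A\<close> outside
  \<open>B\<close> represents the only other coset, so it generates \<open>A\<close> together with
  \<open>B\<close>.\<close>

lemma small_index_gen:
  assumes B: "subgroup B G" and A: "subgroup A G" "B \<subseteq> A" and "\<not> rel_index_ge3 G A B"
  shows "\<exists>a \<in> A. A \<subseteq> generate G (insert a B)"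
proof (cases "A = B")
  case True
  then show ?thesis
    using subgroup.one_closed[OF A(1)] by (intro bexI[of _ \<one>]) (auto intro: generate.incl)
next
  case False
  then obtain a where a: "a \<in> A" "a \<notin> B" using A by blast
  let ?C = "(\<lambda>a. a <# B) ` A"
  have C: "finite ?C" "card ?C < 3"
    using assms(4) by (auto simp: rel_index_ge3_def Let_def)
  have carr: "x \<in> carrier G" if "x \<in> A" for x using subgroup.mem_carrier[OF A(1) that] .
  have "x \<in> generate G (insert a B)" if x: "x \<in> A" for x
  proof (cases "x \<in> B")
    case True
    then show ?thesis by (auto intro: generate.incl)
  next
    case False
    have one: "\<one> <# B = B" using lcos_mult_one subgroup.subset[OF B] by blast
    have "\<one> <# B \<noteq> a <# B" "\<one> <# B \<noteq> x <# B"
      using one a False lcos_self[OF carr[OF a(1)] B] lcos_self[OF carr[OF x] B] by auto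
    moreover have "card {\<one> <# B, a <# B, x <# B} \<le> card ?C"
      using C(1) a x subgroup.one_closed[OF A(1)] by (intro card_mono) auto
    ultimately have "x <# B = a <# B"
      using C(2) by (auto simp: card_insert_if split: if_splits)
    then have "x \<in> a <# B" using lcos_self[OF carr[OF x] B] by simp
    then obtain b where "b \<in> B" "x = a \<otimes> b" by (auto simp: l_coset_def)
    then show ?thesis by (auto intro!: generate.eng intro: generate.incl)
  qed
  then show ?thesis using a by blast
qed

end

context coset_splitting
begin

text \<open>A splitting can fail to be a non-trivial amalgam in two ways: a side collapses to
  \<open>common\<close>, or both sides contain \<open>common\<close> with index 2. In the second
  case, as in the infinite dihedral group, two elements generate \<open>H\<close> over
  \<open>common\<close>.\<close>

lemma common_eq_sides_cases:
  assumes "\<not> nontrivial_amalgam G H"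
  shows "common = side True \<or> common = side False \<or>
    (\<exists>a \<in> H. \<exists>b \<in> H. H \<subseteq> generate G (insert a (insert b common)))"
proof (cases "common = side True \<or> common = side False")
  case False
  then have *: "\<not> rel_index_ge3 G (side True) common" "\<not> rel_index_ge3 G (side False) common"
    using assms amalgamated_product side_Int unfolding nontrivial_amalgam_def by metis+
  obtain a where a: "a \<in> side True" "side True \<subseteq> generate G (insert a common)"
    using small_index_gen[OF subgroup_C subgroup_A C_le *(1)] by blast
  obtain b where b: "b \<in> side False" "side False \<subseteq> generate G (insert b common)"
    using small_index_gen[OF subgroup_C subgroup_A C_le *(2)] by blast
  let ?K = "generate G (insert a (insert b common))"
  have K: "subgroup ?K G"
    using a b A_carrier C_carrier by (intro generate_is_subgroup) auto
  have "side True \<subseteq> ?K"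
    using a(2) mono_generate[of "insert a common" "insert a (insert b common)"] by auto
  moreover have "side False \<subseteq> ?K"
    using b(2) mono_generate[of "insert b common" "insert a (insert b common)"] by auto
  ultimately have "H \<subseteq> ?K"
    using sides_generate generate_subgroup_incl[OF _ K] by (metis Un_least)
  then show ?thesis using a(1) b(1) side_le_H by blast
qed auto

end

section \<open>Paths and colour changes\<close>

context coset_graph
begin

lemma letter_edge_inj:
  assumes "fst l \<in> S" "g \<in> carrier G"
  shows "inj_on (\<lambda>v. letter_edge l (g <# v)) V"
proof (rule inj_onI)
  fix u v assume uv: "u \<in> V" "v \<in> V" "letter_edge l (g <# u) = letter_edge l (g <# v)"
  have s: "fst l \<in> carrier G" using assms gens by auto
  have gu: "g <# u \<in> V" "g <# v \<in> V" using uv assms V_act by auto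
  have "g <# u = g <# v"
  proof (cases "snd l")
    case True
    then have "inv (fst l) <# (g <# u) = inv (fst l) <# (g <# v)"
      using uv by (simp add: letter_edge_def)
    then show ?thesis using V_act_inv(2)[OF gu(1) s] V_act_inv(2)[OF gu(2) s] by metis
  qed (use uv in \<open>simp add: letter_edge_def\<close>)
  then show "u = v"
    using V_act_inv(1)[OF uv(1) assms(2)] V_act_inv(1)[OF uv(2) assms(2)] by metis
qed

text \<open>At a fixed position of \<open>w\<close> the traversed edge determines the starting
  vertex, so each edge of \<open>B\<close> is met there from at most one vertex; there are
  \<open>length w\<close> positions.\<close>

lemma card_paths_meeting:
  assumes "finite V" "finite B" "w \<in> words_over S"
  shows "card {v \<in> V. \<exists>e \<in> set (path_edges v w). e \<in> B} \<le> length w * card B"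
  using assms(3)
proof (induction w)
  case (Cons l w)
  let ?M = "\<lambda>w. {v \<in> V. \<exists>e \<in> set (path_edges v w). e \<in> B}"
  let ?L = "{v \<in> V. letter_edge l (word_eval G w <# v) \<in> B}"
  have w: "w \<in> words_over S" "fst l \<in> S" using Cons by auto
  have "card ?L \<le> card B"
  proof (rule card_inj_on_le[OF _ _ assms(2)])
    show "inj_on (\<lambda>v. letter_edge l (word_eval G w <# v)) ?L"
      using letter_edge_inj[OF w(2) word_eval_closed[OF gens(1) w(1)]] by (rule inj_on_subset) auto
  qed auto
  moreover have "?M (l # w) = ?L \<union> ?M w" by auto
  moreover have "card (?L \<union> ?M w) \<le> card ?L + card (?M w)" by (rule card_Un_le)
  ultimately show ?case using Cons.IH[OF w(1)] by simp
qed simp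

lemma length_path_edges: "length (path_edges v w) = length w"
  by (induction w) auto

lemma path_monochromatic:
  assumes "w \<in> words_over S" "v \<in> V" "\<And>e. e \<in> set (path_edges v w) \<Longrightarrow> f (snd e <# fst e) = f (fst e)"
  shows "f (word_eval G w <# v) = f v \<and> (\<forall>e \<in> set (path_edges v w). f (fst e) = f v)"
  using assms(1,3)
proof (induction w)
  case Nil
  then show ?case using assms(2) by (simp add: V_act_one)
next
  case (Cons l w)
  have w: "w \<in> words_over S" "word_eval G w \<in> carrier G" "fst l \<in> carrier G"
    using Cons.prems(1) word_eval_closed[OF gens(1)] gens(1) by auto
  let ?u = "word_eval G w <# v"
  have u: "?u \<in> V" using V_act[OF assms(2) w(2)] .
  have IH: "f ?u = f v" "\<forall>e \<in> set (path_edges v w). f (fst e) = f v"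
    using Cons.IH[OF w(1)] Cons.prems(2) by auto
  have "word_eval G (l # w) <# v = letter_value G l <# ?u"
    using w assms(2) by (simp add: word_eval_Cons V_act_mult letter_value_closed del: word_eval.simps(2))
  moreover have "f (snd (letter_edge l ?u) <# fst (letter_edge l ?u)) = f (fst (letter_edge l ?u))"
    using Cons.prems(2) by simp
  then have "f (letter_value G l <# ?u) = f ?u \<and> f (fst (letter_edge l ?u)) = f ?u"
    using V_act_inv(2)[OF u w(3)] by (cases "snd l") (auto simp: letter_edge_def letter_value_def)
  ultimately show ?case using IH by simp
qed

end

context group
begin

lemma min_gens_le_generators:
  assumes "subgroup H G" "A \<subseteq> H" "finite A" "H \<subseteq> generate G A"
  shows "min_gens G H \<le> card A"
  using assms generate_subgroup_incl[OF assms(2,1)] by (intro min_gens_le) auto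

text \<open>\<open>W\<close> collects the edges joining different colours and the edges of all relator loops that
  contain such an edge. For each colour \<open>i\<close>, every relator loop then lies in \<open>W\<close> together with
  the edges of colour \<open>i\<close>, or in \<open>W\<close> together with the other edges, so \<open>H\<close> splits over the
  subgroup generated by \<open>W\<close>. If no such splitting is a non-trivial amalgam, then a single colour
  generates \<open>H\<close> modulo \<open>W\<close>, or no colour contributes anything beyond \<open>W\<close>, or \<open>H\<close> is
  generated by \<open>W\<close> and two more elements.\<close>

proposition rank_bound:
  fixes f :: "'a set \<Rightarrow> nat"
  assumes S: "finite S" "S \<subseteq> carrier G" "generate G S = carrier G"
    and R: "finite R" "R \<subseteq> words_over S" "\<And>r. r \<in> R \<Longrightarrow> word_eval G r = \<one>"
    and pres: "\<And>w. w \<in> words_over S \<Longrightarrow> word_eval G w = \<one> \<Longrightarrow> consequence R w"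
    and H: "subgroup H G" "finite (lcosets H)" and no_amalgam: "\<not> nontrivial_amalgam G H"
    and m: "\<And>i. card {v \<in> lcosets H. f v = i} \<le> m"
  shows "min_gens G H \<le>
    (1 + (\<Sum>r\<in>R. length r * length r)) * card {e \<in> (lcosets H) \<times> S. f (snd e <# fst e) \<noteq> f (fst e)}
    + m * card S + 2"
proof -
  obtain t where cg: "coset_graph G S H t"
    and spanning: "\<And>v. v \<in> lcosets H \<Longrightarrow> \<exists>w \<in> words_over S. word_eval G w <# H = v \<and>
      (\<forall>e \<in> set (coset_graph.path_edges G H w). coset_graph.edge_gen G t e = \<one>)"
    using spanning_tree_ex[OF S(2,3) H(1)] by blast
  interpret cg: coset_graph G S H t by (rule cg)
  let ?V = "lcosets H"
  define B where "B = {e \<in> ?V \<times> S. f (snd e <# fst e) \<noteq> f (fst e)}"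
  define M where "M r = {v \<in> ?V. \<exists>e \<in> set (cg.path_edges v r). e \<in> B}" for r
  define W where "W = B \<union> (\<Union>r\<in>R. \<Union>v\<in>M r. set (cg.path_edges v r))"
  have fin_B: "finite B" unfolding B_def using S(1) H(2) by auto
  have fin_M: "finite (M r)" for r unfolding M_def using H(2) by auto
  have W_sub: "W \<subseteq> ?V \<times> S"
  proof -
    have "set (cg.path_edges v r) \<subseteq> ?V \<times> S" if "r \<in> R" "v \<in> M r" for r v
      using that cg.path_edges_closed[of r v] R(2) unfolding M_def by blast
    then show ?thesis unfolding W_def B_def by blast
  qed
  have fin_VS: "finite (?V \<times> S)" using S(1) H(2) by simp
  then have fin_W: "finite W" using W_sub finite_subset by blast
  have card_W: "card W \<le> (1 + (\<Sum>r\<in>R. length r * length r)) * card B"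
  proof -
    \<comment> \<open>One factor \<open>length r\<close> counts the positions at which a loop can
      meet an edge of \<open>B\<close>, the other the edges that such a loop adds to
      \<open>W\<close>.\<close>
    have "card (\<Union>v\<in>M r. set (cg.path_edges v r)) \<le> length r * length r * card B" if "r \<in> R" for r
    proof -
      have "card (\<Union>v\<in>M r. set (cg.path_edges v r)) \<le> (\<Sum>v\<in>M r. card (set (cg.path_edges v r)))"
        by (rule card_UN_le[OF fin_M])
      also have "\<dots> \<le> (\<Sum>v\<in>M r. length r)"
        by (intro sum_mono order_trans[OF card_length]) (simp add: cg.length_path_edges)
      also have "\<dots> = card (M r) * length r" by simp
      also have "\<dots> \<le> length r * card B * length r"
        using cg.card_paths_meeting[OF H(2) fin_B] R(2) that unfolding M_def
        by (intro mult_right_mono) auto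
      finally show ?thesis by (simp add: algebra_simps)
    qed
    then have "(\<Sum>r\<in>R. card (\<Union>v\<in>M r. set (cg.path_edges v r))) \<le> (\<Sum>r\<in>R. length r * length r) * card B"
      unfolding sum_distrib_right by (rule sum_mono)
    moreover have "card W \<le> card B + card (\<Union>r\<in>R. \<Union>v\<in>M r. set (cg.path_edges v r))"
      unfolding W_def by (rule card_Un_le)
    moreover have "card (\<Union>r\<in>R. \<Union>v\<in>M r. set (cg.path_edges v r))
        \<le> (\<Sum>r\<in>R. card (\<Union>v\<in>M r. set (cg.path_edges v r)))"
      by (rule card_UN_le[OF R(1)])
    ultimately show ?thesis by (simp add: add_mult_distrib)
  qed
  \<comment> \<open>The flag b selects the edges of colour i or those of all other colours. An edge
    takes the colour of its source; outside \<open>W\<close> its target has the same colour.\<close>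
  define E where "E i b = W \<union> {e \<in> ?V \<times> S. (f (fst e) = i) = b}" for i b
  have E_Int: "E i True \<inter> E i False = W" for i unfolding E_def by auto
  have rel: "\<exists>b. set (cg.path_edges v r) \<subseteq> E i b" if r: "r \<in> R" and v: "v \<in> ?V" for r v i
  proof (cases "v \<in> M r")
    case True
    then have "set (cg.path_edges v r) \<subseteq> W" using r unfolding W_def by blast
    then show ?thesis unfolding E_def by blast
  next
    case False
    have VS: "set (cg.path_edges v r) \<subseteq> ?V \<times> S" using cg.path_edges_closed[of r v] r v R(2) by blast
    have "f (snd e <# fst e) = f (fst e)" if "e \<in> set (cg.path_edges v r)" for e
      using False v that VS unfolding M_def B_def by blast
    then have "\<forall>e \<in> set (cg.path_edges v r). f (fst e) = f v"
      using cg.path_monochromatic[of r v f] r v R(2) by blast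
    then have "set (cg.path_edges v r) \<subseteq> E i (f v = i)"
      using VS unfolding E_def by auto
    then show ?thesis ..
  qed
  have cs: "coset_splitting G S H t R (E i)" for i
  proof (intro coset_splitting.intro cg coset_splitting_axioms.intro)
    show "E i True \<union> E i False = ?V \<times> S" unfolding E_def using W_sub by auto
  qed (use R pres rel spanning in auto)
  let ?C = "generate G (cg.edge_gen ` W)"
  have cases: "?C = generate G (cg.edge_gen ` E i True) \<or> H \<subseteq> generate G (cg.edge_gen ` E i True) \<or>
     (\<exists>a \<in> H. \<exists>b \<in> H. H \<subseteq> generate G (insert a (insert b ?C)))" for i
  proof -
    interpret cs: coset_splitting G S H t R "E i" by (rule cs)
    have C: "cs.common = ?C" unfolding cs.common_def E_Int ..
    \<comment> \<open>If the other colours contribute nothing beyond \<open>common\<close>, the side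
      of colour i is everything.\<close>
    have "H \<subseteq> cs.side True" if "cs.common = cs.side False"
    proof -
      have "cs.side True \<union> cs.side False = cs.side True" using that cs.C_le[of True] by blast
      then have "generate G (cs.side True) = H" using cs.sides_generate by simp
      then show ?thesis using generate_subgroup_incl[OF subset_refl cs.subgroup_A] by blast
    qed
    then show ?thesis
      using cs.common_eq_sides_cases[OF no_amalgam] unfolding C cs.side_def by blast
  qed
  have W_H: "cg.edge_gen ` W \<subseteq> H" using cg.edge_gens_in_H[OF W_sub] .
  have card_gW: "card (cg.edge_gen ` W) \<le> card W" using card_image_le[OF fin_W] .
  \<comment> \<open>The second and third alternatives settle the bound as soon as they hold for one
    colour; if they fail for every colour, the first holds for all of them simultaneously.\<close>
  consider (side) i where "H \<subseteq> generate G (cg.edge_gen ` E i True)"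
    | (dihedral) a b where "a \<in> H" "b \<in> H" "H \<subseteq> generate G (insert a (insert b ?C))"
    | (common) "\<And>i. ?C = generate G (cg.edge_gen ` E i True)"
    using cases by blast
  then have "min_gens G H \<le> card W + m * card S + 2"
  proof cases
    case (side i)
    have E_sub: "E i True \<subseteq> ?V \<times> S" unfolding E_def using W_sub by blast
    have fin_E: "finite (E i True)" using finite_subset[OF E_sub fin_VS] .
    have "min_gens G H \<le> card (cg.edge_gen ` E i True)"
      using min_gens_le_generators[OF H(1) cg.edge_gens_in_H[OF E_sub] _ side] fin_E by blast
    also have "\<dots> \<le> card (E i True)" using card_image_le[OF fin_E] .
    also have "E i True = W \<union> {v \<in> ?V. f v = i} \<times> S" unfolding E_def by auto
    also have "card \<dots> \<le> card W + card ({v \<in> ?V. f v = i} \<times> S)" by (rule card_Un_le)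
    also have "\<dots> \<le> card W + m * card S" using m[of i] by (simp add: card_cartesian_product)
    finally show ?thesis by simp
  next
    case (dihedral a b)
    let ?A = "insert a (insert b (cg.edge_gen ` W))"
    have A: "?A \<subseteq> H" using dihedral W_H by blast
    have "subgroup (generate G ?A) G"
      using A subgroup.subset[OF H(1)] by (intro generate_is_subgroup) blast
    moreover have "insert a (insert b ?C) \<subseteq> generate G ?A"
      using mono_generate[of "cg.edge_gen ` W" ?A] by (auto intro: generate.incl)
    ultimately have "H \<subseteq> generate G ?A"
      using dihedral(3) generate_subgroup_incl by blast
    then have "min_gens G H \<le> card ?A"
      using min_gens_le_generators[OF H(1) A] fin_W by simp
    also have "\<dots> \<le> card (cg.edge_gen ` W) + 2"
      using fin_W by (simp add: card_insert_if)
    finally show ?thesis using card_gW by simp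
  next
    case common
    have "cg.edge_gen e \<in> ?C" if "e \<in> ?V \<times> S" for e
    proof -
      have "e \<in> E (f (fst e)) True" using that unfolding E_def by simp
      then show ?thesis unfolding common[of "f (fst e)"] by (intro generate.incl imageI)
    qed
    then have "cg.edge_gen ` (?V \<times> S) \<subseteq> ?C" by (rule image_subsetI)
    moreover have "subgroup ?C G"
      using W_H subgroup.subset[OF H(1)] by (intro generate_is_subgroup) blast
    ultimately have "H \<subseteq> ?C"
      using generate_subgroup_incl cg.edge_gens_generate by blast
    then have "min_gens G H \<le> card (cg.edge_gen ` W)"
      using min_gens_le_generators[OF H(1) W_H] fin_W by simp
    then show ?thesis using card_gW by simp
  qed
  then show ?thesis using card_W unfolding B_def by linarith
qed

end

section \<open>Chains of finite index subgroups\<close>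

lemma min_gens_attained:
  assumes "A \<subseteq> H" "finite A" "generate G A = H"
  obtains A' where "A' \<subseteq> H" "finite A'" "generate G A' = H" "card A' = min_gens G H"
proof -
  have "\<exists>n. \<exists>A. A \<subseteq> H \<and> finite A \<and> card A = n \<and> generate G A = H"
    using assms by blast
  from LeastI_ex[OF this] show ?thesis
    using that unfolding min_gens_def by blast
qed

locale chain = group G for G (structure) +
  fixes \<Gamma> :: "nat \<Rightarrow> 'a set"
  assumes is_chain: "is_chain G \<Gamma>"
begin

abbreviation level :: "nat \<Rightarrow> 'a set set" where "level n \<equiv> lcosets (\<Gamma> n)"

abbreviation idx :: "nat \<Rightarrow> nat" where "idx n \<equiv> group_index G (\<Gamma> n)"

text \<open>For \<open>v = g <# \<Gamma> m\<close> and n \<le> m the product absorbs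
  \<open>\<Gamma> m\<close> and leaves \<open>g <# \<Gamma> n\<close>, the ancestor of v on level n
  of the coset tree.\<close>

definition up :: "nat \<Rightarrow> 'a set \<Rightarrow> 'a set" where "up n v = v <#> \<Gamma> n"

lemma subgroup_\<Gamma>: "subgroup (\<Gamma> n) G"
  and finite_level: "finite (level n)"
  and \<Gamma>_0: "\<Gamma> 0 = carrier G"
  and \<Gamma>_Suc: "\<Gamma> (Suc n) \<subset> \<Gamma> n"
  using is_chain unfolding is_chain_def finite_index_def by simp_all

lemma \<Gamma>_antimono: "n \<le> m \<Longrightarrow> \<Gamma> m \<subseteq> \<Gamma> n"
  using lift_Suc_antimono_le[of \<Gamma>] \<Gamma>_Suc by blast

lemma \<Gamma>_carrier: "\<Gamma> n \<subseteq> carrier G"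
  using subgroup.subset[OF subgroup_\<Gamma>] .

lemmas level_act = lcosets_act[OF subgroup_\<Gamma>]
lemmas level_act_mult = lcosets_act_mult[OF subgroup_\<Gamma>]
lemmas level_act_one = lcosets_act_one[OF subgroup_\<Gamma>]
lemmas level_base = self_lcoset[OF subgroup_\<Gamma>]

lemma levelE:
  assumes "v \<in> level n"
  obtains g where "g \<in> carrier G" "v = g <# \<Gamma> n"
  using assms by (auto simp: LCOSETS_def)

lemma levelI: "g \<in> carrier G \<Longrightarrow> g <# \<Gamma> n \<in> level n"
  by (auto simp: LCOSETS_def)

lemma level_nonempty: "v \<in> level n \<Longrightarrow> v \<noteq> {}"
  using lcos_self[OF _ subgroup_\<Gamma>] by (auto elim!: levelE)

lemma level_act_inv:
  "v \<in> level n \<Longrightarrow> g \<in> carrier G \<Longrightarrow> inv g <# (g <# v) = v"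
  "v \<in> level n \<Longrightarrow> g \<in> carrier G \<Longrightarrow> g <# (inv g <# v) = v"
  using level_act_mult[of v n "inv g" g] level_act_mult[of v n g "inv g"] level_act_one[of v n] by auto

lemma \<Gamma>_mult:
  assumes "n \<le> m"
  shows "\<Gamma> m <#> \<Gamma> n = \<Gamma> n"
proof
  show "\<Gamma> m <#> \<Gamma> n \<subseteq> \<Gamma> n"
    using \<Gamma>_antimono[OF assms] subgroup.m_closed[OF subgroup_\<Gamma>[of n]] by (auto simp: set_mult_def)
  show "\<Gamma> n \<subseteq> \<Gamma> m <#> \<Gamma> n"
  proof
    fix x assume x: "x \<in> \<Gamma> n"
    then have "x = \<one> \<otimes> x" using subgroup.mem_carrier[OF subgroup_\<Gamma>] by simp
    then show "x \<in> \<Gamma> m <#> \<Gamma> n"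
      using x subgroup.one_closed[OF subgroup_\<Gamma>[of m]] unfolding set_mult_def by blast
  qed
qed

lemma up_coset:
  assumes "n \<le> m" "g \<in> carrier G"
  shows "up n (g <# \<Gamma> m) = g <# \<Gamma> n"
  using assms setmult_lcos_assoc[OF \<Gamma>_carrier \<Gamma>_carrier assms(2), of m n]
  by (simp add: up_def \<Gamma>_mult)

lemma up_level: "n \<le> m \<Longrightarrow> v \<in> level m \<Longrightarrow> up n v \<in> level n"
  by (auto elim!: levelE simp: up_coset levelI)

lemma up_act:
  assumes "n \<le> m" "v \<in> level m" "g \<in> carrier G"
  shows "up n (g <# v) = g <# up n v"
  using assms by (auto elim!: levelE simp: up_coset lcos_m_assoc[OF \<Gamma>_carrier])

lemma up_superset:
  assumes "n \<le> m" "v \<in> level m"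
  shows "v \<subseteq> up n v"
proof -
  obtain g where g: "g \<in> carrier G" "v = g <# \<Gamma> m" using assms(2) by (rule levelE)
  show ?thesis
    unfolding g(2) up_coset[OF assms(1) g(1)] using \<Gamma>_antimono[OF assms(1)]
    by (auto simp: l_coset_def)
qed

lemma up_eqI:
  assumes "n \<le> m" "v \<in> level m" "u \<in> level n" "v \<subseteq> u"
  shows "up n v = u"
proof (rule ccontr)
  assume "up n v \<noteq> u"
  then have "up n v \<inter> u = {}"
    using lcos_disjoint[OF subgroup_\<Gamma>] up_level assms by blast
  then show False
    using up_superset[OF assms(1,2)] assms(4) level_nonempty[OF assms(2)] by blast
qed

lemma card_fibre:
  assumes "n \<le> m" "u \<in> level n"
  shows "card {v \<in> level m. up n v = u} = card {v \<in> level m. up n v = \<Gamma> n}"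
proof -
  obtain g where g: "g \<in> carrier G" "u = g <# \<Gamma> n" using assms(2) by (rule levelE)
  have "bij_betw (\<lambda>v. g <# v) {v \<in> level m. up n v = \<Gamma> n} {v \<in> level m. up n v = u}"
  proof (rule bij_betwI[where g = "\<lambda>v. inv g <# v"]; (intro funcsetI)?)
    fix v assume v: "v \<in> {v \<in> level m. up n v = \<Gamma> n}"
    then show "g <# v \<in> {v \<in> level m. up n v = u}"
      using level_act[of v m g] up_act[OF assms(1) _ g(1), of v] g by simp
    show "inv g <# (g <# v) = v" using v level_act_inv(1)[OF _ g(1), of v m] by simp
  next
    fix v assume v: "v \<in> {v \<in> level m. up n v = u}"
    have "inv g <# u = \<Gamma> n" using level_act_inv(1)[OF level_base g(1)] g(2) by simp
    then show "inv g <# v \<in> {v \<in> level m. up n v = \<Gamma> n}"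
      using v level_act[of v m "inv g"] up_act[OF assms(1), of v "inv g"] g by simp
    show "g <# (inv g <# v) = v" using v level_act_inv(2)[OF _ g(1), of v m] by simp
  qed
  then show ?thesis by (rule bij_betw_same_card[symmetric])
qed

lemma idx_fibre:
  assumes "n \<le> m" "u \<in> level n"
  shows "idx n * card {v \<in> level m. up n v = u} = idx m"
proof -
  have "card (level m) = (\<Sum>u\<in>level n. card {v \<in> level m. up n v = u})"
  proof -
    have "level m = (\<Union>u\<in>level n. {v \<in> level m. up n v = u})"
      using up_level[OF assms(1)] by blast
    also have "card \<dots> = (\<Sum>u\<in>level n. card {v \<in> level m. up n v = u})"
      using finite_level by (intro card_UN_disjoint) auto
    finally show ?thesis .
  qed
  also have "\<dots> = card (level n) * card {v \<in> level m. up n v = u}"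
    using card_fibre[OF assms(1)] assms(2) by simp
  finally show ?thesis by (simp add: group_index_def)
qed

lemma idx_pos: "idx n > 0"
  using finite_level level_base by (auto simp: group_index_def card_gt_0_iff)

lemma idx_strict: "idx n < idx (Suc n)"
proof -
  let ?F = "{v \<in> level (Suc n). up n v = \<Gamma> n}"
  obtain g where g: "g \<in> \<Gamma> n" "g \<notin> \<Gamma> (Suc n)" using \<Gamma>_Suc by blast
  have gc: "g \<in> carrier G" using g \<Gamma>_carrier by blast
  have "up n (g <# \<Gamma> (Suc n)) = \<Gamma> n"
    using up_coset[of n "Suc n" g] gc coset_join3[OF gc subgroup_\<Gamma> g(1)] by simp
  moreover have "up n (\<Gamma> (Suc n)) = \<Gamma> n" using \<Gamma>_mult[of n "Suc n"] by (simp add: up_def)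
  ultimately have "{g <# \<Gamma> (Suc n), \<Gamma> (Suc n)} \<subseteq> ?F"
    using levelI[OF gc] level_base by auto
  moreover have "g <# \<Gamma> (Suc n) \<noteq> \<Gamma> (Suc n)"
    using g lcos_self[OF gc subgroup_\<Gamma>] by auto
  ultimately have "2 \<le> card ?F"
    using card_mono[of ?F "{g <# \<Gamma> (Suc n), \<Gamma> (Suc n)}"] finite_level by simp
  then have "idx n * 2 \<le> idx n * card ?F" by (rule mult_le_mono2)
  also have "\<dots> = idx (Suc n)" using idx_fibre[OF _ level_base, of n "Suc n"] by simp
  finally show ?thesis using idx_pos[of n] by simp
qed

text \<open>What matters is that the indices diverge: this makes the summand -1 in the rank gradient
  terms negligible.\<close>

lemma idx_ge: "n < idx n"
proof (induction n)
  case 0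
  then show ?case by (rule idx_pos)
next
  case (Suc n)
  then show ?case using idx_strict[of n] by linarith
qed

text \<open>Lets Schreier's lemma be applied inside \<open>\<Gamma> n\<close>: the Schreier graph of
  \<open>\<Gamma> m\<close> there lives on the descendants of the base vertex.\<close>

lemma level_subgroup:
  assumes "n \<le> m"
  shows "lcosets\<^bsub>G\<lparr>carrier := \<Gamma> n\<rparr>\<^esub> (\<Gamma> m) = {v \<in> level m. up n v = \<Gamma> n}"
proof -
  have "lcosets\<^bsub>G\<lparr>carrier := \<Gamma> n\<rparr>\<^esub> (\<Gamma> m) = (\<Union>a\<in>\<Gamma> n. {a <# \<Gamma> m})"
    by (simp add: LCOSETS_def)
  also have "\<dots> = {v \<in> level m. up n v = \<Gamma> n}"
  proof (intro Set.set_eqI iffI)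
    fix v assume "v \<in> (\<Union>a\<in>\<Gamma> n. {a <# \<Gamma> m})"
    then obtain a where a: "a \<in> \<Gamma> n" "v = a <# \<Gamma> m" by blast
    then have "a \<in> carrier G" using \<Gamma>_carrier by blast
    then show "v \<in> {v \<in> level m. up n v = \<Gamma> n}"
      using a coset_join3[OF _ subgroup_\<Gamma> a(1)] by (simp add: levelI up_coset[OF assms])
  next
    fix v assume v: "v \<in> {v \<in> level m. up n v = \<Gamma> n}"
    then obtain g where g: "g \<in> carrier G" "v = g <# \<Gamma> m" using levelE by blast
    then have "g <# \<Gamma> n = \<Gamma> n" using v up_coset[OF assms] by simp
    then have "g \<in> \<Gamma> n" using lcos_self[OF g(1) subgroup_\<Gamma>[of n]] by simp
    then show "v \<in> (\<Union>a\<in>\<Gamma> n. {a <# \<Gamma> m})" using g by blast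
  qed
  finally show ?thesis .
qed

lemma finitely_generated_level:
  assumes "finite S" "S \<subseteq> carrier G" "generate G S = carrier G"
  obtains A where "A \<subseteq> \<Gamma> n" "finite A" "generate G A = \<Gamma> n" "card A = min_gens G (\<Gamma> n)"
proof -
  obtain t where "coset_graph G S (\<Gamma> n) t"
    using coset_graph_ex[OF assms(2,3) subgroup_\<Gamma>] .
  then interpret cg: coset_graph G S "\<Gamma> n" t .
  show ?thesis
    using min_gens_attained[OF cg.edge_gens_in_H[OF subset_refl] _ cg.edge_gens_generate]
      assms(1) finite_level that by blast
qed

text \<open>Schreier's bound, without the saving from a spanning tree and multiplied by
  \<open>idx n\<close> to avoid quotients: a smallest generating set of \<open>\<Gamma> n\<close>
  yields one edge generator of \<open>\<Gamma> m\<close> per edge of the Schreier graph.\<close>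

lemma min_gens_level_le:
  assumes "finite S" "S \<subseteq> carrier G" "generate G S = carrier G" and nm: "n \<le> m"
  shows "idx n * min_gens G (\<Gamma> m) \<le> min_gens G (\<Gamma> n) * idx m"
proof -
  obtain A where A: "A \<subseteq> \<Gamma> n" "finite A" "generate G A = \<Gamma> n" "card A = min_gens G (\<Gamma> n)"
    using finitely_generated_level assms(1,2,3) by blast
  let ?K = "G\<lparr>carrier := \<Gamma> n\<rparr>"
  interpret K: group ?K using subgroup.subgroup_is_group[OF subgroup_\<Gamma>] is_group by blast
  have "generate ?K A = carrier ?K"
    using generate_consistent[OF A(1) subgroup_\<Gamma>] A(3) by simp
  moreover have "subgroup (\<Gamma> m) ?K"
    using subgroup_incl[OF subgroup_\<Gamma> subgroup_\<Gamma> \<Gamma>_antimono[OF nm]] .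
  ultimately obtain t where "coset_graph ?K A (\<Gamma> m) t"
    using K.coset_graph_ex[of A "\<Gamma> m"] A(1) by auto
  then interpret cg: coset_graph ?K A "\<Gamma> m" t .
  let ?F = "{v \<in> level m. up n v = \<Gamma> n}"
  have F: "lcosets\<^bsub>?K\<^esub> (\<Gamma> m) = ?F" by (rule level_subgroup[OF nm])
  have fin: "finite (?F \<times> A)" using finite_level A(2) by simp
  have sub: "cg.edge_gen ` (?F \<times> A) \<subseteq> \<Gamma> m"
    using cg.edge_gens_in_H[of "?F \<times> A"] F by simp
  have "generate G (cg.edge_gen ` (?F \<times> A)) = \<Gamma> m"
    using cg.edge_gens_generate F \<Gamma>_antimono[OF nm] sub
      generate_consistent[OF _ subgroup_\<Gamma>[of n], of "cg.edge_gen ` (?F \<times> A)"] by simp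
  then have "min_gens G (\<Gamma> m) \<le> card (cg.edge_gen ` (?F \<times> A))"
    using sub fin unfolding min_gens_def by (intro Least_le) blast
  also have "\<dots> \<le> card ?F * card A"
    using card_image_le[OF fin] by (simp add: card_cartesian_product)
  finally have "idx n * min_gens G (\<Gamma> m) \<le> (idx n * card ?F) * card A"
    by (simp add: mult.assoc)
  then show ?thesis
    using idx_fibre[OF nm level_base] A(4) by (simp add: mult.commute)
qed

text \<open>By Schreier's bound the ratio of \<open>min_gens\<close> to \<open>idx\<close> never
  increases along the chain, so a single good level controls all later ones.\<close>

lemma rank_gradient_zeroI:
  assumes S: "finite S" "S \<subseteq> carrier G" "generate G S = carrier G"
    and small: "\<And>\<eta>::real. \<eta> > 0 \<Longrightarrow> \<exists>n. real (min_gens G (\<Gamma> n)) \<le> \<eta> * real (idx n)"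
  shows "rank_gradient_zero G \<Gamma>"
  unfolding rank_gradient_zero_def
proof (rule LIMSEQ_I)
  fix e :: real assume e: "e > 0"
  then obtain n where n: "real (min_gens G (\<Gamma> n)) \<le> (e / 2) * real (idx n)"
    using small[of "e / 2"] by auto
  \<comment> \<open>Levels beyond k have index above 1/e. This bounds the term when
    \<open>min_gens\<close> is 0 and the numerator is -1.\<close>
  obtain k :: nat where k: "1 / e < real k" using reals_Archimedean2 by blast
  have "norm (rg_term G (\<Gamma> m) - 0) < e" if m: "m \<ge> max n k" for m
  proof -
    have pos: "real (idx n) > 0" "real (idx m) > 0" using idx_pos by auto
    have "real (idx n) * real (min_gens G (\<Gamma> m)) \<le> real (min_gens G (\<Gamma> n)) * real (idx m)"
      using min_gens_level_le[OF S, of n m] m unfolding of_nat_mult[symmetric] of_nat_le_iff by simp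
    also have "\<dots> \<le> (e / 2) * real (idx n) * real (idx m)"
      using n by (intro mult_right_mono) auto
    finally have "real (idx n) * real (min_gens G (\<Gamma> m)) \<le> real (idx n) * ((e / 2) * real (idx m))"
      by (simp add: mult_ac)
    then have 1: "real (min_gens G (\<Gamma> m)) \<le> (e / 2) * real (idx m)"
      using pos(1) by (simp only: mult_le_cancel_left_pos)
    have "real k < real (idx m)" using idx_ge[of m] m by simp
    then have "1 / e < real (idx m)" using k by linarith
    then have 2: "1 < e * real (idx m)" using e by (simp add: field_simps)
    have "\<bar>real (min_gens G (\<Gamma> m)) - 1\<bar> < e * real (idx m)"
      using 1 2 e pos(2) by (simp add: abs_less_iff)
    then show ?thesis
      using pos(2) by (simp add: rg_term_def abs_divide divide_less_eq)
  qed
  then show "\<exists>no. \<forall>m\<ge>no. norm (rg_term G (\<Gamma> m) - 0) < e" by blast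
qed

end

section \<open>The boundary measure\<close>

lemma div_mod_eqI: "i div q = j div q \<Longrightarrow> i mod q = j mod q \<Longrightarrow> i = j" for i j q :: nat
  by (metis div_mult_mod_eq)

context chain
begin

abbreviation boundary where "boundary \<equiv> tree_boundary G \<Gamma>"

abbreviation degree :: "nat \<Rightarrow> nat" where
  "degree n \<equiv> card {w \<in> level (Suc n). up n w = \<Gamma> n}"

lemma idx_degree: "idx (Suc n) = idx n * degree n"
  using idx_fibre[OF _ level_base, of n "Suc n"] by simp

lemma degree_pos: "degree n > 0"
  using idx_degree[of n] idx_pos[of "Suc n"] by (simp add: zero_less_mult_iff)

lemma boundaryD: "c \<in> boundary \<Longrightarrow> c n \<in> level n" "c \<in> boundary \<Longrightarrow> c (Suc n) \<subseteq> c n"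
  by (auto simp: tree_boundary_def)

lemma boundary_antimono: "c \<in> boundary \<Longrightarrow> n \<le> m \<Longrightarrow> c m \<subseteq> c n"
  using lift_Suc_antimono_le[of c] boundaryD(2) by blast

lemma boundary_up: "c \<in> boundary \<Longrightarrow> n \<le> m \<Longrightarrow> up n (c m) = c n"
  using up_eqI boundaryD(1) boundary_antimono by blast

text \<open>Enumerations of the levels along which the children of vertex \<open>j\<close> of level \<open>n\<close> are the
  vertices \<open>j q, \<dots>, j q + q - 1\<close> of level \<open>n + 1\<close>, where \<open>q = degree n\<close>.\<close>

lemma compatible_enumeration:
  obtains e where "\<And>n. bij_betw (e n) {..<idx n} (level n)"
    and "\<And>n j. j < idx (Suc n) \<Longrightarrow> up n (e (Suc n) j) = e n (j div degree n)"
proof -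
  have "\<exists>\<phi>. bij_betw \<phi> {..<degree n} {w \<in> level (Suc n). up n w = v}" if v: "v \<in> level n" for n v
  proof -
    have "finite {w \<in> level (Suc n). up n w = v}" using finite_level by simp
    from ex_bij_betw_nat_finite[OF this] show ?thesis
      using card_fibre[OF _ v, of "Suc n"] by (auto simp: atLeast0LessThan)
  qed
  note ex = this
  define \<phi> where "\<phi> n v = (SOME \<phi>. bij_betw \<phi> {..<degree n} {w \<in> level (Suc n). up n w = v})" for n v
  have \<phi>: "bij_betw (\<phi> n v) {..<degree n} {w \<in> level (Suc n). up n w = v}" if "v \<in> level n" for n v
    unfolding \<phi>_def using ex[OF that] by (rule someI_ex)
  obtain e0 where e0: "bij_betw e0 {..<idx 0} (level 0)"
    using ex_bij_betw_nat_finite[OF finite_level] by (metis atLeast0LessThan group_index_def)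
  define e where "e = rec_nat e0 (\<lambda>n f j. \<phi> n (f (j div degree n)) (j mod degree n))"
  have e_Suc: "e (Suc n) j = \<phi> n (e n (j div degree n)) (j mod degree n)" for n j
    by (simp add: e_def)
  have div_less: "j div degree n < idx n" if "j < idx (Suc n)" for n j
    using that by (simp add: idx_degree less_mult_imp_div_less)
  have child: "e (Suc n) j \<in> level (Suc n) \<and> up n (e (Suc n) j) = e n (j div degree n)"
    if "bij_betw (e n) {..<idx n} (level n)" "j < idx (Suc n)" for n j
  proof -
    have "e n (j div degree n) \<in> level n"
      using that(1) div_less[OF that(2)] by (auto simp: bij_betw_def)
    from \<phi>[OF this] have "\<phi> n (e n (j div degree n)) (j mod degree n)
        \<in> {w \<in> level (Suc n). up n w = e n (j div degree n)}"
      using mod_less_divisor[OF degree_pos[of n], of j] unfolding bij_betw_def by blast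
    then show ?thesis by (simp add: e_Suc)
  qed
  have bij: "bij_betw (e n) {..<idx n} (level n)" for n
  proof (induction n)
    case 0
    then show ?case using e0 by (simp add: e_def)
  next
    case (Suc n)
    have inj: "inj_on (e (Suc n)) {..<idx (Suc n)}"
    proof (rule inj_onI)
      fix i j assume ij: "i \<in> {..<idx (Suc n)}" "j \<in> {..<idx (Suc n)}" "e (Suc n) i = e (Suc n) j"
      then have "e n (i div degree n) = e n (j div degree n)"
        using child[OF Suc, of i] child[OF Suc, of j] by simp
      then have d: "i div degree n = j div degree n"
        using Suc div_less ij(1,2) by (auto simp: bij_betw_def inj_on_def)
      have "e n (j div degree n) \<in> level n"
        using Suc div_less ij(2) by (auto simp: bij_betw_def)
      from \<phi>[OF this] have "inj_on (\<phi> n (e n (j div degree n))) {..<degree n}"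
        by (simp add: bij_betw_def)
      moreover have "\<phi> n (e n (j div degree n)) (i mod degree n) = \<phi> n (e n (j div degree n)) (j mod degree n)"
        using ij(3) d by (simp add: e_Suc)
      ultimately have "i mod degree n = j mod degree n"
        using mod_less_divisor[OF degree_pos[of n]] by (auto dest: inj_onD)
      with d show "i = j" by (rule div_mod_eqI)
    qed
    have "e (Suc n) ` {..<idx (Suc n)} \<subseteq> level (Suc n)"
      using child[OF Suc] by blast
    moreover have "card (e (Suc n) ` {..<idx (Suc n)}) = card (level (Suc n))"
      using card_image[OF inj] by (simp add: group_index_def)
    ultimately have "e (Suc n) ` {..<idx (Suc n)} = level (Suc n)"
      using finite_level by (intro card_subset_eq)
    then show ?case using inj by (simp add: bij_betw_def)
  qed
  show ?thesis
    using that[of e] bij child by blast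
qed

text \<open>\<open>boundary_action_strongly_ergodic\<close> asserts that a measure exists, so its
  negation says something about the action only once a measure is at hand. Lebesgue measure on [0,1)
  is transported: x goes to the ray whose vertex on level n has number floor(x *
  \<open>idx n\<close>), and a shadow pulls back to an interval of length
  1/\<open>idx n\<close>.\<close>

lemma boundary_measure_ex: "\<exists>M. boundary_measure G \<Gamma> M"
proof -
  obtain e where e: "\<And>n. bij_betw (e n) {..<idx n} (level n)"
    and e_up: "\<And>n j. j < idx (Suc n) \<Longrightarrow> up n (e (Suc n) j) = e n (j div degree n)"
    using compatible_enumeration by blast
  define k where "k n x = nat \<lfloor>x * real (idx n)\<rfloor>" for n and x :: real
  have k_less: "k n x < idx n" if "x \<in> {0..<1}" for n x
  proof -
    have "x * real (idx n) < real (idx n)" using that idx_pos[of n] by simp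
    then have "\<lfloor>x * real (idx n)\<rfloor> < int (idx n)" by (simp add: floor_less_iff)
    then show ?thesis using that idx_pos[of n] by (simp add: k_def nat_less_iff)
  qed
  have k_Suc: "k (Suc n) x div degree n = k n x" if "x \<in> {0..<1}" for n x
  proof -
    have "\<lfloor>x * real (idx n)\<rfloor> = \<lfloor>x * real (idx (Suc n)) / real_of_int (int (degree n))\<rfloor>"
      using degree_pos[of n] by (simp add: idx_degree)
    also have "\<dots> = \<lfloor>x * real (idx (Suc n))\<rfloor> div int (degree n)"
      by (rule floor_divide_real_eq_div) simp
    finally show ?thesis
      using that by (simp add: k_def nat_div_distrib)
  qed
  define ray where "ray x n = e n (k n x)" for x n
  have ray: "ray x \<in> boundary" if "x \<in> {0..<1}" for x
  proof -
    have lev: "ray x n \<in> level n" for n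
      using e[of n] k_less[OF that] by (auto simp: ray_def bij_betw_def)
    have "up n (ray x (Suc n)) = ray x n" for n
      using e_up[OF k_less[OF that]] k_Suc[OF that] by (simp add: ray_def)
    then have "ray x (Suc n) \<subseteq> ray x n" for n
      using up_superset[OF _ lev, of n "Suc n"] by simp
    then show ?thesis using lev by (simp add: tree_boundary_def)
  qed
  define L where "L = restrict_space lborel {0..<1::real}"
  have L: "space L = {0..<1}" "sets L = sets (restrict_space borel {0..<1})"
    by (simp_all add: L_def space_restrict_space sets_restrict_space)
  have preimage: "\<exists>j < idx n. ray -` shadow G \<Gamma> n C \<inter> space L = {real j / real (idx n)..<(real j + 1) / real (idx n)}"
    if C: "C \<in> level n" for n C
  proof -
    obtain j where j: "j < idx n" "C = e n j" using e[of n] C by (auto simp: bij_betw_def)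
    have N: "real (idx n) > 0" using idx_pos by simp
    have "x \<in> ray -` shadow G \<Gamma> n C \<inter> space L \<longleftrightarrow> x \<in> {real j / real (idx n)..<(real j + 1) / real (idx n)}" for x
    proof -
      have iff: "real j / real (idx n) \<le> x \<and> x < (real j + 1) / real (idx n) \<longleftrightarrow> \<lfloor>x * real (idx n)\<rfloor> = int j"
        using N by (simp add: floor_eq_iff field_simps)
      have "x \<in> {0..<1}" if "x \<in> {real j / real (idx n)..<(real j + 1) / real (idx n)}"
      proof -
        have "0 \<le> real j / real (idx n)" by simp
        moreover have "(real j + 1) / real (idx n) \<le> 1" using j N by (simp add: field_simps)
        ultimately show ?thesis using that unfolding atLeastLessThan_iff by linarith
      qed
      moreover have "ray x n = C \<longleftrightarrow> \<lfloor>x * real (idx n)\<rfloor> = int j" if "x \<in> {0..<1}"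
      proof -
        have "ray x n = C \<longleftrightarrow> k n x = j"
          using e[of n] k_less[OF that] j by (auto simp: ray_def bij_betw_def inj_on_def)
        also have "\<dots> \<longleftrightarrow> \<lfloor>x * real (idx n)\<rfloor> = int j"
          using that by (auto simp: k_def)
        finally show ?thesis .
      qed
      ultimately show ?thesis
        using ray iff by (auto simp: L shadow_def)
    qed
    then show ?thesis using j by blast
  qed
  define M where "M = distr L (sigma boundary (shadows G \<Gamma>)) ray"
  have sub: "shadows G \<Gamma> \<subseteq> Pow boundary" by (auto simp: shadows_def shadow_def)
  have meas: "ray \<in> measurable L (sigma boundary (shadows G \<Gamma>))"
  proof (rule measurable_measure_of[OF sub])
    show "ray \<in> space L \<rightarrow> boundary" using ray L by auto
    fix Y assume "Y \<in> shadows G \<Gamma>"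
    then obtain n C where "Y = shadow G \<Gamma> n C" "C \<in> level n" by (auto simp: shadows_def)
    then obtain j where Y: "ray -` Y \<inter> space L = {real j / real (idx n)..<(real j + 1) / real (idx n)}"
      using preimage by blast
    have "ray -` Y \<inter> space L \<subseteq> {0..<1}" using L by auto
    then show "ray -` Y \<inter> space L \<in> sets L"
      unfolding Y L(2) by (subst sets_restrict_space_iff) auto
  qed
  have pL: "prob_space L"
    by (rule prob_spaceI) (simp add: L_def emeasure_restrict_space space_restrict_space)
  show ?thesis
  proof (intro exI[of _ M], unfold boundary_measure_def, intro conjI allI impI)
    show "prob_space M" unfolding M_def by (rule prob_space.prob_space_distr[OF pL meas])
    show "space M = boundary" using sub by (simp add: M_def)
    show "sets M = sigma_sets boundary (shadows G \<Gamma>)" using sub by (simp add: M_def)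
    fix n C assume C: "C \<in> level n"
    then have S: "shadow G \<Gamma> n C \<in> sets (sigma boundary (shadows G \<Gamma>))"
      using sub by (auto simp: shadows_def)
    obtain j where j: "j < idx n" "ray -` shadow G \<Gamma> n C \<inter> space L
        = {real j / real (idx n)..<(real j + 1) / real (idx n)}"
      using preimage[OF C] by blast
    have "ray -` shadow G \<Gamma> n C \<inter> space L \<subseteq> {0..<1}" using L by auto
    then have "measure M (shadow G \<Gamma> n C) = measure lborel {real j / real (idx n)..<(real j + 1) / real (idx n)}"
      unfolding M_def measure_distr[OF meas S] j(2) unfolding L_def by (intro measure_restrict_space) auto
    also have "\<dots> = 1 / real (idx n)"
      using idx_pos[of n] by (simp add: divide_right_mono add_divide_distrib)
    finally show "measure M (shadow G \<Gamma> n C) = 1 / real (idx n)" .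
  qed
qed

end

abbreviation sym_diff :: "'x set \<Rightarrow> 'x set \<Rightarrow> 'x set" where
  "sym_diff A B \<equiv> (A - B) \<union> (B - A)"

lemma (in finite_measure) measure_sym_diff_triangle:
  assumes "A \<in> sets M" "B \<in> sets M" "C \<in> sets M"
  shows "measure M (sym_diff A C) \<le> measure M (sym_diff A B) + measure M (sym_diff B C)"
proof -
  have "measure M (sym_diff A C) \<le> measure M (sym_diff A B \<union> sym_diff B C)"
    using assms by (intro finite_measure_mono) auto
  also have "\<dots> \<le> measure M (sym_diff A B) + measure M (sym_diff B C)"
    using assms by (intro measure_Un_le) auto
  finally show ?thesis .
qed

lemma (in finite_measure) measure_le_sym_diff:
  assumes "A \<in> sets M" "B \<in> sets M"
  shows "measure M A \<le> measure M B + measure M (sym_diff A B)"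
proof -
  have "measure M A \<le> measure M (B \<union> sym_diff A B)"
    using assms by (intro finite_measure_mono) auto
  also have "\<dots> \<le> measure M B + measure M (sym_diff A B)"
    using assms by (intro measure_Un_le) auto
  finally show ?thesis .
qed

locale boundary_space = chain G \<Gamma> + prob_space M
  for G :: "('a, 'b) monoid_scheme" (structure) and \<Gamma> and M :: "(nat \<Rightarrow> 'a set) measure" +
  assumes boundary_measure: "boundary_measure G \<Gamma> M"
begin

abbreviation "act \<equiv> boundary_act G"

lemma space_M: "space M = boundary"
  and sets_M: "sets M = sigma_sets boundary (shadows G \<Gamma>)"
  and measure_shadow: "C \<in> level n \<Longrightarrow> measure M (shadow G \<Gamma> n C) = 1 / real (idx n)"
  using boundary_measure unfolding boundary_measure_def by simp_all

section \<open>Clopen subsets of the boundary\<close>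

definition cylinder :: "nat \<Rightarrow> 'a set set \<Rightarrow> (nat \<Rightarrow> 'a set) set" where
  "cylinder n D = {c \<in> boundary. c n \<in> D}"

lemma shadow_eq_cylinder: "shadow G \<Gamma> n C = cylinder n {C}"
  by (auto simp: shadow_def cylinder_def)

lemma cylinder_eq_UN: "cylinder n D = (\<Union>C\<in>D. shadow G \<Gamma> n C)"
  by (auto simp: shadow_def cylinder_def)

lemma sets_shadow: "C \<in> level n \<Longrightarrow> shadow G \<Gamma> n C \<in> sets M"
  unfolding sets_M by (intro sigma_sets.Basic) (auto simp: shadows_def)

lemma sets_cylinder: "D \<subseteq> level n \<Longrightarrow> cylinder n D \<in> sets M"
  unfolding cylinder_eq_UN using finite_subset[OF _ finite_level] sets_shadow
  by (intro sets.finite_UN) auto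

lemma measure_cylinder:
  assumes "D \<subseteq> level n"
  shows "measure M (cylinder n D) = real (card D) / real (idx n)"
proof -
  have fin: "finite D" using assms finite_subset finite_level by blast
  have "measure M (\<Union>C\<in>D. shadow G \<Gamma> n C) = (\<Sum>C\<in>D. measure M (shadow G \<Gamma> n C))"
  proof (rule finite_measure_finite_Union[OF fin])
    show "(\<lambda>C. shadow G \<Gamma> n C) ` D \<subseteq> sets M" using assms sets_shadow by blast
    show "disjoint_family_on (\<lambda>C. shadow G \<Gamma> n C) D"
      by (auto simp: disjoint_family_on_def shadow_def)
  qed
  also have "\<dots> = (\<Sum>C\<in>D. 1 / real (idx n))"
    using assms measure_shadow by (intro sum.cong) auto
  finally show ?thesis by (simp add: cylinder_eq_UN)
qed

lemma cylinder_raise: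
  assumes "n \<le> m"
  shows "cylinder n D = cylinder m {v \<in> level m. up n v \<in> D}"
  using boundary_up[OF _ assms] boundaryD(1) by (auto simp: cylinder_def)

lemma cylinder_Compl: "boundary - cylinder n D = cylinder n (level n - D)"
  using boundaryD(1) by (auto simp: cylinder_def)

text \<open>Finite unions of shadows of one level. As a cylinder is also a cylinder over every later
  level, any two of these sets can be compared on a common level, so they form an algebra.\<close>

definition clopens :: "(nat \<Rightarrow> 'a set) set set" where
  "clopens = {cylinder n D | n D. D \<subseteq> level n}"

lemma common_level:
  assumes "A \<in> clopens" "B \<in> clopens"
  obtains n D E where "D \<subseteq> level n" "E \<subseteq> level n" "A = cylinder n D" "B = cylinder n E"
proof -
  obtain i D j E where *: "A = cylinder i D" "B = cylinder j E"
    using assms by (auto simp: clopens_def)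
  have "A = cylinder (max i j) {v \<in> level (max i j). up i v \<in> D}"
    "B = cylinder (max i j) {v \<in> level (max i j). up j v \<in> E}"
    unfolding * by (intro cylinder_raise; simp)+
  then show ?thesis by (intro that) auto
qed

lemma clopens_Un:
  assumes "A \<in> clopens" "B \<in> clopens"
  shows "A \<union> B \<in> clopens"
proof -
  obtain n D E where "D \<subseteq> level n" "E \<subseteq> level n" "A = cylinder n D" "B = cylinder n E"
    using common_level[OF assms] .
  then have "A \<union> B = cylinder n (D \<union> E)" "D \<union> E \<subseteq> level n" by (auto simp: cylinder_def)
  then show ?thesis unfolding clopens_def by blast
qed

lemma clopens_Int:
  assumes "A \<in> clopens" "B \<in> clopens"
  shows "A \<inter> B \<in> clopens"
proof -
  obtain n D E where "D \<subseteq> level n" "E \<subseteq> level n" "A = cylinder n D" "B = cylinder n E"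
    using common_level[OF assms] .
  then have "A \<inter> B = cylinder n (D \<inter> E)" "D \<inter> E \<subseteq> level n" by (auto simp: cylinder_def)
  then show ?thesis unfolding clopens_def by blast
qed

lemma clopens_Compl: "A \<in> clopens \<Longrightarrow> boundary - A \<in> clopens"
  unfolding clopens_def using cylinder_Compl by blast

lemma clopens_empty: "{} \<in> clopens"
  unfolding clopens_def by (rule CollectI, rule exI[of _ 0], rule exI[of _ "{}"]) (auto simp: cylinder_def)

lemma clopens_boundary: "boundary \<in> clopens"
  using clopens_Compl[OF clopens_empty] by simp

lemma clopens_sets: "A \<in> clopens \<Longrightarrow> A \<in> sets M"
  unfolding clopens_def using sets_cylinder by blast

lemma sets_clopens: "sets M = sigma_sets boundary clopens"
proof
  have "shadows G \<Gamma> \<subseteq> clopens"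
    unfolding shadows_def clopens_def shadow_eq_cylinder by blast
  then show "sets M \<subseteq> sigma_sets boundary clopens"
    unfolding sets_M by (rule sigma_sets_mono')
  have "sigma_sets (space M) clopens \<subseteq> sets M"
    using clopens_sets by (intro sets.sigma_sets_subset) blast
  then show "sigma_sets boundary clopens \<subseteq> sets M" by (simp add: space_M)
qed

section \<open>The measure-preserving action\<close>

lemma act_boundary:
  assumes g: "g \<in> carrier G" and c: "c \<in> boundary"
  shows "act g c \<in> boundary"
  unfolding tree_boundary_def
proof (intro CollectI conjI allI)
  show "act g c n \<in> level n" for n
    using level_act[OF boundaryD(1)[OF c] g] by (simp add: boundary_act_def)
  show "act g c (Suc n) \<subseteq> act g c n" for n
    using boundaryD(2)[OF c] by (auto simp: boundary_act_def l_coset_def)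
qed

lemma act_inv:
  assumes "g \<in> carrier G" "c \<in> boundary"
  shows "act (inv g) (act g c) = c" "act g (act (inv g) c) = c"
  using level_act_inv[OF boundaryD(1)[OF assms(2)] assms(1)] by (simp_all add: boundary_act_def)

lemma act_image:
  assumes g: "g \<in> carrier G" and B: "B \<subseteq> boundary"
  shows "act g ` B = act (inv g) -` B \<inter> boundary"
proof (intro equalityI subsetI)
  fix c assume "c \<in> act g ` B"
  then show "c \<in> act (inv g) -` B \<inter> boundary"
    using act_inv(1)[OF g] act_boundary[OF g] B by auto
next
  fix c assume "c \<in> act (inv g) -` B \<inter> boundary"
  then show "c \<in> act g ` B"
    using act_inv(2)[OF g, of c] by (metis IntE imageI vimageE)
qed

lemma act_cylinder:
  assumes g: "g \<in> carrier G" and D: "D \<subseteq> level n"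
  shows "act g -` cylinder n D \<inter> boundary = cylinder n {v \<in> level n. g <# v \<in> D}"
  using act_boundary[OF g] boundaryD(1) by (auto simp: cylinder_def boundary_act_def)

lemma card_translate:
  assumes g: "g \<in> carrier G" and D: "D \<subseteq> level n"
  shows "card {v \<in> level n. g <# v \<in> D} = card D"
proof -
  have "bij_betw (\<lambda>v. g <# v) {v \<in> level n. g <# v \<in> D} D"
  proof (rule bij_betwI[where g = "\<lambda>v. inv g <# v"]; (intro funcsetI)?)
    fix v assume v: "v \<in> D"
    then have "v \<in> level n" using D by blast
    then show "inv g <# v \<in> {v \<in> level n. g <# v \<in> D}"
      using v level_act[of v n "inv g"] level_act_inv(2)[of v n g] g by simp
    show "g <# (inv g <# v) = v" using level_act_inv(2)[OF \<open>v \<in> level n\<close> g] .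
  next
    fix v assume v: "v \<in> {v \<in> level n. g <# v \<in> D}"
    then show "g <# v \<in> D" "inv g <# (g <# v) = v" using level_act_inv(1)[of v n g] g by auto
  qed
  then show ?thesis by (rule bij_betw_same_card)
qed

lemma measurable_act: "g \<in> carrier G \<Longrightarrow> act g \<in> measurable M M"
proof (rule measurable_sigma_sets[OF sets_clopens])
  assume g: "g \<in> carrier G"
  show "clopens \<subseteq> Pow boundary" by (auto simp: clopens_def cylinder_def)
  show "act g \<in> space M \<rightarrow> boundary" using act_boundary[OF g] space_M by auto
  fix Y assume "Y \<in> clopens"
  then obtain n D where "Y = cylinder n D" "D \<subseteq> level n" by (auto simp: clopens_def)
  then show "act g -` Y \<inter> space M \<in> sets M"
    using act_cylinder[OF g] sets_cylinder[of "{v \<in> level n. g <# v \<in> D}" n] space_M by auto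
qed

lemma distr_act:
  assumes g: "g \<in> carrier G"
  shows "distr M M (act g) = M"
proof (rule measure_eqI_generator_eq[where E = clopens and \<Omega> = boundary and A = "\<lambda>_. boundary"])
  show "Int_stable clopens" using clopens_Int by (rule Int_stableI)
  show "clopens \<subseteq> Pow boundary" by (auto simp: clopens_def cylinder_def)
  show "sets (distr M M (act g)) = sigma_sets boundary clopens" "sets M = sigma_sets boundary clopens"
    using sets_clopens by simp_all
  show "range (\<lambda>_. boundary) \<subseteq> clopens" using clopens_boundary by auto
  show "emeasure (distr M M (act g)) boundary \<noteq> \<infinity>"
    using emeasure_distr[OF measurable_act[OF g]] clopens_sets[OF clopens_boundary] by simp
  fix X assume X: "X \<in> clopens"
  then obtain n D where D: "X = cylinder n D" "D \<subseteq> level n" by (auto simp: clopens_def)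
  have "emeasure (distr M M (act g)) X = emeasure M (cylinder n {v \<in> level n. g <# v \<in> D})"
    using emeasure_distr[OF measurable_act[OF g] clopens_sets[OF X]] act_cylinder[OF g D(2)]
    by (simp add: space_M D(1))
  also have "\<dots> = emeasure M X"
    unfolding emeasure_eq_measure D(1) using D(2) card_translate[OF g D(2)]
    by (simp add: measure_cylinder)
  finally show "emeasure (distr M M (act g)) X = emeasure M X" .
qed auto

lemma act_sets:
  assumes "g \<in> carrier G" "B \<in> sets M"
  shows "act g ` B \<in> sets M" "measure M (act g ` B) = measure M B"
proof -
  have i: "inv g \<in> carrier G" using assms by simp
  have "B \<subseteq> boundary" using sets.sets_into_space[OF assms(2)] space_M by simp
  then have im: "act g ` B = act (inv g) -` B \<inter> space M"
    using act_image[OF assms(1)] space_M by simp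
  then show "act g ` B \<in> sets M"
    using measurable_sets[OF measurable_act[OF i] assms(2)] by simp
  show "measure M (act g ` B) = measure M B"
    using measure_distr[OF measurable_act[OF i] assms(2)] unfolding distr_act[OF i] im by simp
qed

lemma act_inj: "g \<in> carrier G \<Longrightarrow> inj_on (act g) boundary"
  using act_inv(1) by (metis inj_onI)

text \<open>The sets with arbitrarily good clopen approximations form a sigma algebra. A countable
  union is cut off to a finite one by continuity of the measure, and the finite union is
  approximated term by term.\<close>

lemma clopen_approximation:
  assumes "A \<in> sets M" "\<epsilon> > 0"
  shows "\<exists>B \<in> clopens. measure M (sym_diff A B) < \<epsilon>"
proof -
  have "A \<in> sigma_sets boundary clopens" using assms(1) sets_clopens by simp
  then have "\<forall>\<epsilon>>0. \<exists>B \<in> clopens. measure M (sym_diff A B) < \<epsilon>"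
  proof induction
    case (Basic A)
    then show ?case by (intro allI impI bexI[of _ A]) auto
  next
    case Empty
    then show ?case using clopens_empty by (intro allI impI bexI[of _ "{}"]) auto
  next
    case (Compl A)
    have A: "A \<subseteq> boundary" using Compl.hyps sets_clopens sets.sets_into_space space_M by blast
    show ?case
    proof (intro allI impI)
      fix \<epsilon> :: real assume "\<epsilon> > 0"
      then obtain B where B: "B \<in> clopens" "measure M (sym_diff A B) < \<epsilon>" using Compl.IH by blast
      have "B \<subseteq> boundary" using B clopens_sets sets.sets_into_space space_M by blast
      then have "sym_diff (boundary - A) (boundary - B) = sym_diff A B" using A by blast
      then show "\<exists>B \<in> clopens. measure M (sym_diff (boundary - A) B) < \<epsilon>"
        using B clopens_Compl by metis
    qed
  next
    case (Union A)
    have A: "A i \<in> sets M" for i using Union.hyps sets_clopens by simp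
    have fin: "\<exists>B \<in> clopens. measure M (sym_diff (\<Union>i<k. A i) B) < \<epsilon>" if "\<epsilon> > 0" for k :: nat and \<epsilon>
      using that
    proof (induction k arbitrary: \<epsilon>)
      case 0
      then show ?case using clopens_empty by (intro bexI[of _ "{}"]) auto
    next
      case (Suc k)
      obtain B where B: "B \<in> clopens" "measure M (sym_diff (\<Union>i<k. A i) B) < \<epsilon> / 2"
        using Suc.IH[of "\<epsilon> / 2"] Suc.prems by auto
      obtain C where C: "C \<in> clopens" "measure M (sym_diff (A k) C) < \<epsilon> / 2"
        using Union.IH[of k] Suc.prems by (meson half_gt_zero)
      note sets = A clopens_sets[OF B(1)] clopens_sets[OF C(1)]
      have "measure M (sym_diff (\<Union>i<Suc k. A i) (B \<union> C))
          \<le> measure M (sym_diff (\<Union>i<k. A i) B \<union> sym_diff (A k) C)"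
        using sets by (intro finite_measure_mono) (auto simp: lessThan_Suc)
      also have "\<dots> \<le> measure M (sym_diff (\<Union>i<k. A i) B) + measure M (sym_diff (A k) C)"
        using sets by (intro measure_Un_le) auto
      also have "\<dots> < \<epsilon>" using B C by simp
      finally show ?case using clopens_Un[OF B(1) C(1)] by blast
    qed
    show ?case
    proof (intro allI impI)
      fix \<epsilon> :: real assume e: "\<epsilon> > 0"
      let ?U = "\<lambda>k::nat. \<Union>i<k. A i"
      have "(\<lambda>k. measure M (?U k)) \<longlonglongrightarrow> measure M (\<Union>k. ?U k)"
        using A by (intro finite_Lim_measure_incseq) (auto simp: incseq_def intro: less_le_trans)
      also have "(\<Union>k. ?U k) = (\<Union>i. A i)" by blast
      finally have lim: "(\<lambda>k. measure M (?U k)) \<longlonglongrightarrow> measure M (\<Union>i. A i)" .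
      obtain k where k: "\<bar>measure M (?U k) - measure M (\<Union>i. A i)\<bar> < \<epsilon> / 2"
        using LIMSEQ_D[OF lim, of "\<epsilon> / 2"] e by auto
      obtain B where B: "B \<in> clopens" "measure M (sym_diff (?U k) B) < \<epsilon> / 2"
        using fin[of "\<epsilon> / 2" k] e by auto
      have "measure M (sym_diff (\<Union>i. A i) (?U k)) = measure M ((\<Union>i. A i) - ?U k)"
        by (rule arg_cong[of _ _ "measure M"]) blast
      also have "\<dots> = measure M (\<Union>i. A i) - measure M (?U k)"
        using A by (intro finite_measure_Diff) auto
      finally have "measure M (sym_diff (\<Union>i. A i) (?U k)) < \<epsilon> / 2" using k by linarith
      then have "measure M (sym_diff (\<Union>i. A i) B) < \<epsilon>"
        using measure_sym_diff_triangle[of "\<Union>i. A i" "?U k" B] A B clopens_sets[OF B(1)]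
        by (simp add: sets.countable_UN)
      then show "\<exists>B \<in> clopens. measure M (sym_diff (\<Union>i. A i) B) < \<epsilon>" using B(1) by blast
    qed
  qed
  then show ?thesis using assms(2) by blast
qed

end

section \<open>Almost invariant sets and colourings\<close>

context boundary_space
begin

text \<open>The bound \<delta> is fixed before \<open>F\<close> and \<epsilon>. As the sequence is
  not trivial, \<theta> \<le> a (1 - a) for infinitely many of its measures a, which puts a between
  \<theta> and 1 - \<theta>; half of \<theta> is given up in passing to a clopen set.\<close>

lemma clopen_almost_invariant:
  assumes "\<not> strongly_ergodic_action G act M"
  obtains \<delta> where "\<delta> > 0" "\<And>F \<epsilon>. finite F \<Longrightarrow> F \<subseteq> carrier G \<Longrightarrow> \<epsilon> > 0 \<Longrightarrow>
    \<exists>B \<in> clopens. \<delta> \<le> measure M B \<and> measure M B \<le> 1 - \<delta> \<and> (\<forall>g \<in> F. measure M (B - act g ` B) \<le> \<epsilon>)"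
proof -
  obtain A where A: "\<And>n. A n \<in> sets M"
    and inv: "\<And>g. g \<in> carrier G \<Longrightarrow> (\<lambda>n. measure M (A n - act g ` A n)) \<longlonglongrightarrow> 0"
    and nontriv: "\<not> (\<lambda>n. measure M (A n) * (1 - measure M (A n))) \<longlonglongrightarrow> 0"
    using assms unfolding strongly_ergodic_action_def by blast
  obtain \<theta> where \<theta>: "\<theta> > 0" "\<And>N. \<exists>n\<ge>N. \<theta> \<le> \<bar>measure M (A n) * (1 - measure M (A n))\<bar>"
    using nontriv unfolding LIMSEQ_iff by (force simp: not_less)
  have "\<exists>B \<in> clopens. \<theta> / 2 \<le> measure M B \<and> measure M B \<le> 1 - \<theta> / 2 \<and>
      (\<forall>g \<in> F. measure M (B - act g ` B) \<le> \<epsilon>)"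
    if F: "finite F" "F \<subseteq> carrier G" and e: "\<epsilon> > 0" for F \<epsilon>
  proof -
    have "\<forall>\<^sub>F n in sequentially. \<forall>g \<in> F. measure M (A n - act g ` A n) < \<epsilon> / 2"
    proof (rule eventually_ball_finite[OF F(1)], rule ballI)
      fix g assume "g \<in> F"
      then show "\<forall>\<^sub>F n in sequentially. measure M (A n - act g ` A n) < \<epsilon> / 2"
        using F(2) e by (intro order_tendstoD(2)[OF inv]) auto
    qed
    then obtain N where N: "\<And>n g. n \<ge> N \<Longrightarrow> g \<in> F \<Longrightarrow> measure M (A n - act g ` A n) < \<epsilon> / 2"
      unfolding eventually_sequentially by blast
    obtain n where n: "n \<ge> N" "\<theta> \<le> \<bar>measure M (A n) * (1 - measure M (A n))\<bar>"
      using \<theta>(2) by blast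
    let ?a = "measure M (A n)"
    have a01: "0 \<le> ?a" "?a \<le> 1" by auto
    then have "\<theta> \<le> ?a * (1 - ?a)" using n(2) by simp
    moreover have "?a * (1 - ?a) \<le> ?a" "?a * (1 - ?a) \<le> 1 - ?a"
      using a01 mult_left_le[of "1 - ?a" ?a] mult_right_le_one_le[of "1 - ?a" ?a] by (auto simp: mult.commute)
    ultimately have a: "\<theta> \<le> ?a" "?a \<le> 1 - \<theta>" by linarith+
    \<comment> \<open>The bound \<theta>/2 keeps the measure of \<open>B\<close> away from 0 and 1.
      The error \<epsilon>/4 is paid twice, for \<open>B\<close> and for its translate, on top of
      \<epsilon>/2 from \<open>A n\<close>.\<close>
    obtain B where B: "B \<in> clopens" "measure M (sym_diff (A n) B) < min (\<epsilon> / 4) (\<theta> / 2)"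
      using clopen_approximation[OF A, of "min (\<epsilon> / 4) (\<theta> / 2)" n] e \<theta>(1) by auto
    note sets = A[of n] clopens_sets[OF B(1)]
    have "sym_diff B (A n) = sym_diff (A n) B" by blast
    then have b: "\<theta> / 2 \<le> measure M B" "measure M B \<le> 1 - \<theta> / 2"
      using measure_le_sym_diff[OF sets] measure_le_sym_diff[OF sets(2,1)] a B(2) by auto
    have "measure M (B - act g ` B) \<le> \<epsilon>" if g: "g \<in> F" for g
    proof -
      have gc: "g \<in> carrier G" using g F by blast
      let ?D = "sym_diff (A n) B"
      have sD: "?D \<in> sets M" using sets by blast
      have "measure M (B - act g ` B) \<le> measure M ((A n - act g ` A n) \<union> ?D \<union> act g ` ?D)"
        using sets sD act_sets(1)[OF gc] by (intro finite_measure_mono) auto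
      also have "\<dots> \<le> measure M ((A n - act g ` A n) \<union> ?D) + measure M (act g ` ?D)"
        using sets sD act_sets(1)[OF gc] by (intro measure_Un_le) auto
      also have "\<dots> \<le> measure M (A n - act g ` A n) + measure M ?D + measure M (act g ` ?D)"
        using sets sD act_sets(1)[OF gc] by (intro add_right_mono measure_Un_le) auto
      finally show ?thesis
        using act_sets(2)[OF gc sD] N[OF n(1) g] B(2) by simp
    qed
    then show ?thesis using B(1) b by blast
  qed
  then show ?thesis using that[of "\<theta> / 2"] \<theta>(1) by simp
qed

lemma level_transitive:
  obtains F where "finite F" "F \<subseteq> carrier G" "\<And>v w. v \<in> level n \<Longrightarrow> w \<in> level n \<Longrightarrow> \<exists>g \<in> F. g <# w = v"
proof -
  have "\<exists>g \<in> carrier G. g <# w = v" if vw: "v \<in> level n" "w \<in> level n" for v w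
  proof -
    obtain a where a: "a \<in> carrier G" "v = a <# \<Gamma> n" using vw(1) by (rule levelE)
    obtain b where b: "b \<in> carrier G" "w = b <# \<Gamma> n" using vw(2) by (rule levelE)
    have "(a \<otimes> inv b) <# w = v"
      using a b level_act_mult[OF vw(2), of a "inv b"] level_act_inv(1)[OF level_base b(1)] by simp
    then show ?thesis using a b by blast
  qed
  then obtain h where h: "\<And>v w. v \<in> level n \<Longrightarrow> w \<in> level n \<Longrightarrow> h v w \<in> carrier G \<and> h v w <# w = v"
    by metis
  show ?thesis
  proof (rule that)
    show "finite ((\<lambda>(v, w). h v w) ` (level n \<times> level n))" using finite_level by blast
    show "(\<lambda>(v, w). h v w) ` (level n \<times> level n) \<subseteq> carrier G" using h by auto
    show "\<exists>g \<in> (\<lambda>(v, w). h v w) ` (level n \<times> level n). g <# w = v"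
      if "v \<in> level n" "w \<in> level n" for v w
      using h that by force
  qed
qed

text \<open>An almost invariant set is almost independent of every fixed clopen set, since the group
  permutes the shadows of a level transitively.\<close>

lemma almost_independent:
  assumes B: "B \<in> sets M" and D: "D \<subseteq> level n"
    and inv: "\<And>v w. v \<in> level n \<Longrightarrow> w \<in> level n \<Longrightarrow>
      \<exists>g \<in> carrier G. g <# w = v \<and> measure M (B - act g ` B) \<le> \<eta>"
  shows "measure M (cylinder n D \<inter> B) \<le> measure M (cylinder n D) * (measure M B + real (idx n) * \<eta>)"
proof -
  have Bb: "B \<subseteq> boundary" using sets.sets_into_space[OF B] space_M by simp
  have sets: "shadow G \<Gamma> n v \<inter> B \<in> sets M" if "v \<in> level n" for v
    using sets_shadow[OF that] B by blast
  have compare: "measure M (shadow G \<Gamma> n v \<inter> B) \<le> measure M (shadow G \<Gamma> n w \<inter> B) + \<eta>"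
    if vw: "v \<in> level n" "w \<in> level n" for v w
  proof -
    obtain g where g: "g \<in> carrier G" "g <# w = v" "measure M (B - act g ` B) \<le> \<eta>"
      using inv[OF vw] by blast
    \<comment> \<open>A point of \<open>B\<close> over v either lies outside the translate of
      \<open>B\<close> by g or comes from a point of \<open>B\<close>, which must then lie over
      w.\<close>
    have "shadow G \<Gamma> n v \<inter> B \<subseteq> act g ` (shadow G \<Gamma> n w \<inter> B) \<union> (B - act g ` B)"
    proof
      fix x assume x: "x \<in> shadow G \<Gamma> n v \<inter> B"
      show "x \<in> act g ` (shadow G \<Gamma> n w \<inter> B) \<union> (B - act g ` B)"
      proof (cases "x \<in> act g ` B")
        case True
        then obtain b where b: "b \<in> B" "x = act g b" by blast
        then have "g <# b n = v" using x by (simp add: shadow_def boundary_act_def)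
        then have "b n = w"
          using level_act_inv(1)[OF boundaryD(1) g(1), of b n] level_act_inv(1)[OF vw(2) g(1)] b Bb g(2)
          by auto
        then have "b \<in> shadow G \<Gamma> n w \<inter> B" using b Bb by (auto simp: shadow_def)
        then show ?thesis using b by blast
      qed (use x in blast)
    qed
    then have "measure M (shadow G \<Gamma> n v \<inter> B)
        \<le> measure M (act g ` (shadow G \<Gamma> n w \<inter> B) \<union> (B - act g ` B))"
      using act_sets(1)[OF g(1)] sets[OF vw(2)] B by (intro finite_measure_mono) auto
    also have "\<dots> \<le> measure M (act g ` (shadow G \<Gamma> n w \<inter> B)) + measure M (B - act g ` B)"
      using act_sets(1)[OF g(1)] sets[OF vw(2)] B by (intro measure_Un_le) auto
    finally show ?thesis using act_sets(2)[OF g(1) sets[OF vw(2)]] g(3) by linarith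
  qed
  have split: "measure M (cylinder n E \<inter> B) = (\<Sum>v\<in>E. measure M (shadow G \<Gamma> n v \<inter> B))"
    if E: "E \<subseteq> level n" for E
  proof -
    have "finite E" using E finite_level finite_subset by blast
    moreover have "(\<lambda>v. shadow G \<Gamma> n v \<inter> B) ` E \<subseteq> sets M" using sets E by blast
    moreover have "disjoint_family_on (\<lambda>v. shadow G \<Gamma> n v \<inter> B) E"
      by (auto simp: disjoint_family_on_def shadow_def)
    ultimately have "measure M (\<Union>v\<in>E. shadow G \<Gamma> n v \<inter> B) = (\<Sum>v\<in>E. measure M (shadow G \<Gamma> n v \<inter> B))"
      by (rule finite_measure_finite_Union)
    moreover have "(\<Union>v\<in>E. shadow G \<Gamma> n v \<inter> B) = cylinder n E \<inter> B"
      unfolding cylinder_eq_UN by blast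
    ultimately show ?thesis by simp
  qed
  have N: "real (idx n) > 0" using idx_pos by simp
  \<comment> \<open>Averaging the comparison over all w of the level brings in the measure of
    \<open>B\<close>.\<close>
  have each: "measure M (shadow G \<Gamma> n v \<inter> B) \<le> (measure M B + real (idx n) * \<eta>) / real (idx n)"
    if v: "v \<in> level n" for v
  proof -
    have "real (idx n) * measure M (shadow G \<Gamma> n v \<inter> B) = (\<Sum>w\<in>level n. measure M (shadow G \<Gamma> n v \<inter> B))"
      by (simp add: group_index_def)
    also have "\<dots> \<le> (\<Sum>w\<in>level n. measure M (shadow G \<Gamma> n w \<inter> B) + \<eta>)"
      using compare[OF v] by (rule sum_mono)
    also have "\<dots> = measure M (cylinder n (level n) \<inter> B) + real (idx n) * \<eta>"
      using split[of "level n"] by (simp add: sum.distrib group_index_def)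
    also have "cylinder n (level n) \<inter> B = B"
      using Bb boundaryD(1) by (auto simp: cylinder_def)
    finally show ?thesis using N by (simp add: field_simps)
  qed
  have "measure M (cylinder n D \<inter> B) \<le> (\<Sum>v\<in>D. (measure M B + real (idx n) * \<eta>) / real (idx n))"
    unfolding split[OF D] using each D by (intro sum_mono) blast
  also have "\<dots> = measure M (cylinder n D) * (measure M B + real (idx n) * \<eta>)"
    by (simp add: measure_cylinder[OF D])
  finally show ?thesis .
qed

lemma measure_translate_diff:
  assumes "g \<in> carrier G" "B \<in> sets M"
  shows "measure M (act g ` B - B) = measure M (B - act g ` B)"
proof -
  have s: "act g ` B \<in> sets M" using act_sets assms by blast
  have "measure M (act g ` B - B) = measure M (act g ` B) - measure M (act g ` B \<inter> B)"
    using finite_measure_Diff'[OF s assms(2)] .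
  moreover have "measure M (B - act g ` B) = measure M B - measure M (B \<inter> act g ` B)"
    using finite_measure_Diff'[OF assms(2) s] .
  ultimately show ?thesis using act_sets(2)[OF assms] by (simp add: Int_commute)
qed

lemma measure_Compl_translate_diff:
  assumes g: "g \<in> carrier G" and B: "B \<in> sets M"
  shows "measure M ((boundary - B) - act g ` (boundary - B)) = measure M (B - act g ` B)"
proof -
  have Bb: "B \<subseteq> boundary" using sets.sets_into_space[OF B] space_M by simp
  have "act g ` boundary = boundary"
    using act_image[OF g subset_refl] act_boundary[of "inv g"] g by auto
  then have "act g ` (boundary - B) = boundary - act g ` B"
    using inj_on_image_set_diff[OF act_inj[OF g], of boundary B] Bb by simp
  moreover have "act g ` B \<subseteq> boundary"
    using act_boundary[OF g] Bb by blast
  ultimately have "(boundary - B) - act g ` (boundary - B) = act g ` B - B" by blast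
  then show ?thesis using measure_translate_diff[OF g B] by simp
qed

text \<open>Where g changes membership in \<open>D\<close>, it maps points into the symmetric
  difference of the cylinder and its translate. The two halves of that difference have equal
  measure, whence the factor 2.\<close>

lemma measure_colour_change:
  assumes g: "g \<in> carrier G" and D: "D \<subseteq> level n"
  shows "measure M (cylinder n {v \<in> level n. (g <# v \<in> D) \<noteq> (v \<in> D)})
    \<le> 2 * measure M (cylinder n D - act g ` cylinder n D)"
proof -
  let ?B = "cylinder n D" and ?X = "cylinder n {v \<in> level n. (g <# v \<in> D) \<noteq> (v \<in> D)}"
  have B: "?B \<in> sets M" "act g ` ?B \<in> sets M" using sets_cylinder[OF D] act_sets[OF g] by auto
  have X: "?X \<in> sets M" by (intro sets_cylinder) auto
  have "act g ` ?X \<subseteq> sym_diff ?B (act g ` ?B)"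
  proof
    fix y assume "y \<in> act g ` ?X"
    then obtain c where c: "c \<in> boundary" "(g <# c n \<in> D) \<noteq> (c n \<in> D)" "y = act g c"
      by (auto simp: cylinder_def)
    have "y \<in> ?B \<longleftrightarrow> g <# c n \<in> D"
      using act_boundary[OF g c(1)] c by (auto simp: cylinder_def boundary_act_def)
    moreover have "y \<in> act g ` ?B \<longleftrightarrow> c n \<in> D"
      using inj_onD[OF act_inj[OF g]] c by (auto simp: cylinder_def)
    ultimately show "y \<in> sym_diff ?B (act g ` ?B)" using c(2) by blast
  qed
  then have "measure M (act g ` ?X) \<le> measure M (sym_diff ?B (act g ` ?B))"
    using B by (intro finite_measure_mono) auto
  also have "\<dots> \<le> measure M (?B - act g ` ?B) + measure M (act g ` ?B - ?B)"
    using B by (intro measure_Un_le) auto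
  finally show ?thesis
    using act_sets(2)[OF g X] measure_translate_diff[OF g B(1)] by simp
qed

text \<open>Colourings with small classes and small boundary arise by repeatedly intersecting with
  almost invariant sets; each step shrinks every class by a definite factor.\<close>

lemma colourings:
  assumes S: "finite S" "S \<subseteq> carrier G" and \<delta>: "\<delta> > 0"
    and inv: "\<And>F \<epsilon>. finite F \<Longrightarrow> F \<subseteq> carrier G \<Longrightarrow> \<epsilon> > 0 \<Longrightarrow>
      \<exists>B \<in> clopens. \<delta> \<le> measure M B \<and> measure M B \<le> 1 - \<delta> \<and> (\<forall>g \<in> F. measure M (B - act g ` B) \<le> \<epsilon>)"
    and \<epsilon>: "\<epsilon> > 0"
  shows "\<exists>n (f :: 'a set \<Rightarrow> nat).
    (\<forall>i. measure M (cylinder n {v \<in> level n. f v = i}) \<le> (1 - \<delta> / 2) ^ m) \<and>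
    (\<forall>s \<in> S. measure M (cylinder n {v \<in> level n. f (s <# v) \<noteq> f v}) \<le> \<epsilon>)"
  using \<epsilon>
proof (induction m arbitrary: \<epsilon>)
  case 0
  have "cylinder 0 {} = {}" by (auto simp: cylinder_def)
  then show ?case using 0 by (intro exI[of _ 0] exI[of _ "\<lambda>_. 0"]) auto
next
  case (Suc m)
  let ?q = "1 - \<delta> / 2"
  obtain n and f :: "'a set \<Rightarrow> nat" where
    f: "\<And>i. measure M (cylinder n {v \<in> level n. f v = i}) \<le> ?q ^ m"
      "\<And>s. s \<in> S \<Longrightarrow> measure M (cylinder n {v \<in> level n. f (s <# v) \<noteq> f v}) \<le> \<epsilon> / 2"
    using Suc.IH[of "\<epsilon> / 2"] Suc.prems by auto
  have N: "real (idx n) > 0" using idx_pos by simp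
  \<comment> \<open>The first bound keeps the error \<open>real (idx n) * \<eta>\<close> of
    \<open>almost_independent\<close> within \<delta>/2; the second keeps the new colour changes, at
    most 2 \<eta>, within the \<epsilon>/2 left by the induction hypothesis.\<close>
  define \<eta> where "\<eta> = min (\<delta> / (2 * real (idx n))) (\<epsilon> / 4)"
  have \<eta>: "\<eta> > 0" "real (idx n) * \<eta> \<le> \<delta> / 2" "2 * \<eta> \<le> \<epsilon> / 2"
  proof -
    show "\<eta> > 0" using \<delta> N Suc.prems by (simp add: \<eta>_def)
    have "real (idx n) * \<eta> \<le> real (idx n) * (\<delta> / (2 * real (idx n)))"
      using N by (intro mult_left_mono) (auto simp: \<eta>_def)
    then show "real (idx n) * \<eta> \<le> \<delta> / 2" using N by simp
    show "2 * \<eta> \<le> \<epsilon> / 2" by (simp add: \<eta>_def min_def)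
  qed
  obtain F where F: "finite F" "F \<subseteq> carrier G"
    "\<And>v w. v \<in> level n \<Longrightarrow> w \<in> level n \<Longrightarrow> \<exists>g \<in> F. g <# w = v"
    using level_transitive by blast
  \<comment> \<open>\<open>F\<close> moves any vertex of level n to any other and gives independence
    from the old colours; \<open>S\<close> keeps the new colour changes rare.\<close>
  obtain B where B: "B \<in> clopens" "\<delta> \<le> measure M B" "measure M B \<le> 1 - \<delta>"
    "\<And>g. g \<in> F \<union> S \<Longrightarrow> measure M (B - act g ` B) \<le> \<eta>"
    using inv[of "F \<union> S" \<eta>] F(1,2) S \<eta>(1) by (metis Un_least finite_UnI)
  obtain k D where D: "B = cylinder k D" "D \<subseteq> level k" using B(1) by (auto simp: clopens_def)
  have B_sets: "B \<in> sets M" "boundary - B \<in> sets M"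
    using clopens_sets clopens_Compl B(1) by blast+
  have B_compl: "measure M (boundary - B) \<le> 1 - \<delta>"
    using prob_compl[OF B_sets(1)] B(2) space_M by simp
  \<comment> \<open>The new colour encodes the pair of old colour and membership in
    \<open>B\<close>; both are read off on the common level l through ancestors.\<close>
  define l where "l = max n k"
  have l: "n \<le> l" "k \<le> l" by (simp_all add: l_def)
  define f' where "f' v = 2 * f (up n v) + of_bool (up k v \<in> D)" for v
  have f'_ray: "f' (c l) = 2 * f (c n) + of_bool (c k \<in> D)" if "c \<in> boundary" for c
    using boundary_up[OF that l(1)] boundary_up[OF that l(2)] by (simp add: f'_def)
  \<comment> \<open>Stated for C because it serves both \<open>B\<close> and its complement. The new
    factor is (1 - \<delta>) + \<delta>/2.\<close>
  have small: "measure M (cylinder n {v \<in> level n. f v = i} \<inter> C) \<le> ?q ^ Suc m"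
    if C: "C \<in> sets M" "measure M C \<le> 1 - \<delta>"
      "\<And>g. g \<in> F \<Longrightarrow> measure M (C - act g ` C) \<le> \<eta>" for C i
  proof -
    have "\<exists>g \<in> carrier G. g <# w = v \<and> measure M (C - act g ` C) \<le> \<eta>"
      if "v \<in> level n" "w \<in> level n" for v w
      using F(2,3) C(3) that by blast
    then have "measure M (cylinder n {v \<in> level n. f v = i} \<inter> C)
        \<le> measure M (cylinder n {v \<in> level n. f v = i}) * (measure M C + real (idx n) * \<eta>)"
      using C(1) by (intro almost_independent) auto
    also have "\<dots> \<le> ?q ^ m * ?q"
    proof (rule mult_mono)
      show "measure M C + real (idx n) * \<eta> \<le> ?q" using C(2) \<eta>(2) by linarith
      show "0 \<le> ?q ^ m" using f(1)[of 0] measure_nonneg order_trans by blast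
    qed (use f(1) \<eta>(1) in auto)
    finally show ?thesis by (simp add: mult.commute)
  qed
  show ?case
  proof (intro exI conjI allI ballI)
    fix i
    let ?F = "cylinder n {v \<in> level n. f v = i div 2}"
    have iff: "2 * a + of_bool b = i \<longleftrightarrow> a = i div 2 \<and> b = odd i" for a b
      by (cases b) auto
    have eq: "cylinder l {v \<in> level l. f' v = i} = (if odd i then ?F \<inter> B else ?F \<inter> (boundary - B))"
      using boundaryD(1) by (auto simp: cylinder_def f'_ray iff D(1))
    have B_inv: "measure M (B - act g ` B) \<le> \<eta>" "measure M ((boundary - B) - act g ` (boundary - B)) \<le> \<eta>"
      if "g \<in> F" for g
      using B(4)[of g] measure_Compl_translate_diff[OF _ B_sets(1), of g] that F(2) by auto
    show "measure M (cylinder l {v \<in> level l. f' v = i}) \<le> ?q ^ Suc m"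
      unfolding eq using small[OF B_sets(1) B(3) B_inv(1)] small[OF B_sets(2) B_compl B_inv(2)] by simp
  next
    fix s assume s: "s \<in> S"
    then have sc: "s \<in> carrier G" using S by blast
    let ?Y = "cylinder n {v \<in> level n. f (s <# v) \<noteq> f v}"
    let ?X = "cylinder k {v \<in> level k. (s <# v \<in> D) \<noteq> (v \<in> D)}"
    have sets: "?Y \<in> sets M" "?X \<in> sets M" by (auto intro: sets_cylinder)
    have "cylinder l {v \<in> level l. f' (s <# v) \<noteq> f' v} \<subseteq> ?Y \<union> ?X"
    proof
      fix c assume "c \<in> cylinder l {v \<in> level l. f' (s <# v) \<noteq> f' v}"
      then have c: "c \<in> boundary" "f' (s <# c l) \<noteq> f' (c l)" by (auto simp: cylinder_def)
      have "f' (s <# c l) = 2 * f (s <# c n) + of_bool (s <# c k \<in> D)"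
        using f'_ray[OF act_boundary[OF sc c(1)]] by (simp add: boundary_act_def)
      then have "f (s <# c n) \<noteq> f (c n) \<or> (s <# c k \<in> D) \<noteq> (c k \<in> D)"
        using c(2) f'_ray[OF c(1)] by auto
      then show "c \<in> ?Y \<union> ?X" using c(1) boundaryD(1) by (auto simp: cylinder_def)
    qed
    then have "measure M (cylinder l {v \<in> level l. f' (s <# v) \<noteq> f' v}) \<le> measure M (?Y \<union> ?X)"
      using sets by (intro finite_measure_mono) auto
    also have "\<dots> \<le> measure M ?Y + measure M ?X" using sets by (rule measure_Un_le)
    also have "\<dots> \<le> \<epsilon> / 2 + 2 * \<eta>"
      using f(2)[OF s] measure_colour_change[OF sc D(2)] B(4)[of s] s D(1) by simp
    finally show "measure M (cylinder l {v \<in> level l. f' (s <# v) \<noteq> f' v}) \<le> \<epsilon>"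
      using \<eta>(3) by linarith
  qed
qed

lemma card_edges_le:
  assumes "finite S" and b: "\<And>s. s \<in> S \<Longrightarrow> real (card {v \<in> level n. P v s}) \<le> b"
  shows "real (card {e \<in> (level n) \<times> S. P (fst e) (snd e)}) \<le> real (card S) * b"
proof -
  have "{e \<in> (level n) \<times> S. P (fst e) (snd e)} = (\<Union>s\<in>S. (\<lambda>v. (v, s)) ` {v \<in> level n. P v s})" by auto
  also have "card \<dots> \<le> (\<Sum>s\<in>S. card ((\<lambda>v. (v, s)) ` {v \<in> level n. P v s}))"
    by (rule card_UN_le[OF assms(1)])
  also have "\<dots> \<le> (\<Sum>s\<in>S. card {v \<in> level n. P v s})"
    using finite_level by (intro sum_mono card_image_le) simp
  finally have "real (card {e \<in> (level n) \<times> S. P (fst e) (snd e)}) \<le> (\<Sum>s\<in>S. real (card {v \<in> level n. P v s}))"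
    unfolding of_nat_sum[symmetric] of_nat_le_iff .
  also have "\<dots> \<le> (\<Sum>s\<in>S. b)" using b by (rule sum_mono)
  finally show ?thesis by simp
qed

end

theorem theorem2:
  fixes G :: "('a, 'b) monoid_scheme" and \<Gamma> :: "nat \<Rightarrow> 'a set"
  assumes "finitely_presented G"
    and "is_chain G \<Gamma>"
  shows "boundary_action_strongly_ergodic G \<Gamma> \<or> rank_gradient_zero G \<Gamma> \<or>
         (\<exists>n. nontrivial_amalgam G (\<Gamma> n))"
proof (rule ccontr)
  assume "\<not> ?thesis"
  then have not_se: "\<not> boundary_action_strongly_ergodic G \<Gamma>"
    and not_rg: "\<not> rank_gradient_zero G \<Gamma>" and no_amalgam: "\<not> nontrivial_amalgam G (\<Gamma> n)" for n
    by auto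
  obtain S R where G: "group G" and S: "finite S" "S \<subseteq> carrier G" "generate G S = carrier G"
    and R: "finite R" "R \<subseteq> words_over S" "\<And>r. r \<in> R \<Longrightarrow> word_eval G r = \<one>\<^bsub>G\<^esub>"
    and pres: "\<And>w. w \<in> words_over S \<Longrightarrow> word_eval G w = \<one>\<^bsub>G\<^esub> \<Longrightarrow> consequence R w"
    using assms(1) unfolding finitely_presented_def by blast
  interpret chain G \<Gamma> using G assms(2) by (simp add: chain_def chain_axioms_def)
  obtain M where M: "boundary_measure G \<Gamma> M" using boundary_measure_ex ..
  then have "prob_space M" by (simp add: boundary_measure_def)
  then interpret boundary_space G \<Gamma> M
    using M chain_axioms by (simp add: boundary_space_def boundary_space_axioms_def)
  have "\<not> strongly_ergodic_action G (boundary_act G) M"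
    using not_se M unfolding boundary_action_strongly_ergodic_def by blast
  then obtain \<delta> where \<delta>: "\<delta> > 0" and inv: "\<And>F \<epsilon>. finite F \<Longrightarrow> F \<subseteq> carrier G \<Longrightarrow> \<epsilon> > 0 \<Longrightarrow>
      \<exists>B \<in> clopens. \<delta> \<le> measure M B \<and> measure M B \<le> 1 - \<delta> \<and> (\<forall>g \<in> F. measure M (B - act g ` B) \<le> \<epsilon>)"
    by (rule clopen_almost_invariant) blast
  have \<delta>_le: "\<delta> \<le> 1 / 2"
    using inv[of "{}" 1] by auto
  let ?q = "1 - \<delta> / 2"
  define K where "K = 1 + (\<Sum>r\<in>R. length r * length r)"
  have "\<exists>n. real (min_gens G (\<Gamma> n)) \<le> \<theta> * real (idx n)" if \<theta>: "\<theta> > 0" for \<theta> :: real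
  proof -
    \<comment> \<open>The colour classes and the colour changes get \<theta>/2 each. The summand 2
      in the denominator of \<sigma> makes room for the additive constant of the rank bound; the
      summand 1 in that of \<epsilon> keeps it nonzero when \<open>S\<close> is empty.\<close>
    define \<sigma> where "\<sigma> = \<theta> / (2 * (real (card S) + 2))"
    define \<epsilon> where "\<epsilon> = \<theta> / (2 * (real K * real (card S) + 1))"
    have pos: "\<sigma> > 0" "\<epsilon> > 0"
      unfolding \<sigma>_def \<epsilon>_def using \<theta> by (intro divide_pos_pos mult_pos_pos add_nonneg_pos; simp)+
    obtain m where m: "?q ^ m < \<sigma>"
      using real_arch_pow_inv[OF pos(1), of ?q] \<delta> by auto
    obtain n and f :: "'a set \<Rightarrow> nat" where
      f: "\<And>i. measure M (cylinder n {v \<in> level n. f v = i}) \<le> ?q ^ m"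
        "\<And>s. s \<in> S \<Longrightarrow> measure M (cylinder n {v \<in> level n. f (s <#\<^bsub>G\<^esub> v) \<noteq> f v}) \<le> \<epsilon>"
      using colourings[OF S(1,2) \<delta> inv pos(2), of m] by blast
    have half: "x * (\<theta> / (2 * x)) = \<theta> / 2" if "x > 0" for x :: real
      using that by simp
    let ?N = "real (idx n)"
    have N: "?N > 0" using idx_pos by simp
    have size: "real (card {v \<in> level n. f v = i}) \<le> \<sigma> * ?N" for i
    proof -
      have "real (card {v \<in> level n. f v = i}) / ?N \<le> \<sigma>"
        using f(1)[of i] m by (subst measure_cylinder[symmetric]) auto
      then show ?thesis using N by (simp add: divide_le_eq)
    qed
    have change: "real (card {v \<in> level n. f (s <#\<^bsub>G\<^esub> v) \<noteq> f v}) \<le> \<epsilon> * ?N" if "s \<in> S" for s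
    proof -
      have "real (card {v \<in> level n. f (s <#\<^bsub>G\<^esub> v) \<noteq> f v}) / ?N \<le> \<epsilon>"
        using f(2)[OF that] by (subst measure_cylinder[symmetric]) auto
      then show ?thesis using N by (simp add: divide_le_eq)
    qed
    \<comment> \<open>The class of the base vertex is not empty, so \<open>\<sigma> * ?N\<close> is
      at least 1 and the constant 2 of the rank bound is absorbed into a multiple of the
      index.\<close>
    have "0 < card {v \<in> level n. f v = f (\<Gamma> n)}"
      using level_base finite_level by (auto simp: card_gt_0_iff)
    then have one: "1 \<le> \<sigma> * ?N"
      using size[of "f (\<Gamma> n)"] by linarith
    define c where "c = nat \<lfloor>\<sigma> * ?N\<rfloor>"
    have c: "real c \<le> \<sigma> * ?N" using one by (simp add: c_def)
    have class_c: "card {v \<in> level n. f v = i} \<le> c" for i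
      using size[of i] unfolding c_def by (simp add: le_nat_floor)
    let ?E = "{e \<in> (level n) \<times> S. f (snd e <#\<^bsub>G\<^esub> fst e) \<noteq> f (fst e)}"
    have E: "real (card ?E) \<le> real (card S) * (\<epsilon> * ?N)"
      using card_edges_le[OF S(1), of n "\<lambda>v s. f (s <#\<^bsub>G\<^esub> v) \<noteq> f v"] change by simp
    have "min_gens G (\<Gamma> n) \<le> K * card ?E + c * card S + 2"
      using rank_bound[OF S R pres subgroup_\<Gamma> finite_level no_amalgam class_c]
      unfolding K_def .
    then have "real (min_gens G (\<Gamma> n)) \<le> real (K * card ?E + c * card S + 2)"
      by (simp only: of_nat_le_iff)
    also have "\<dots> = real K * real (card ?E) + real c * real (card S) + 2" by simp
    also have "\<dots> \<le> real K * (real (card S) * (\<epsilon> * ?N)) + (\<sigma> * ?N) * real (card S) + 2 * (\<sigma> * ?N)"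
      using E c one by (intro add_mono mult_left_mono mult_right_mono) auto
    also have "\<dots> = (real K * real (card S)) * \<epsilon> * ?N + (real (card S) + 2) * \<sigma> * ?N"
      by (simp add: algebra_simps)
    also have "\<dots> \<le> (real K * real (card S) + 1) * \<epsilon> * ?N + (real (card S) + 2) * \<sigma> * ?N"
      using pos N by (intro add_mono mult_right_mono) auto
    also have "(real K * real (card S) + 1) * \<epsilon> = \<theta> / 2"
      unfolding \<epsilon>_def by (rule half) (intro add_nonneg_pos; simp)
    also have "(real (card S) + 2) * \<sigma> = \<theta> / 2"
      unfolding \<sigma>_def by (rule half) simp
    finally show ?thesis by (intro exI[of _ n]) simp
  qed
  then show False using not_rg rank_gradient_zeroI[OF S] by blast
qed

end
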